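(* Let $\mathcal{R}$ be a TRS over $\mathcal{F}$ that is compatible with a sort attachment $\mathcal{S}$. If $\mathcal{R}$ is left-linear and confluent on $\mathcal{T}_{\mathcal{S}}(\mathcal{F},\mathcal{V})$, then $\mathcal{R}$ is confluent.
   Context: Let $S$ be a set of sorts equipped with a precedence $\succ$, with reflexive closure $\succeq$. A sort attachment $\mathcal{S}$ assigns each $f\in\mathcal{F}$ of arity $n$ a type $f:\alpha_1\times\cdots\times\alpha_n\to\alpha$ with $\alpha_i,\alpha\in S$, and assigns each variable a sort. The set $\mathcal{V}_\alpha$ of variables of sort $\alpha$ is countably infinite for each $\alpha$. Order-sorted terms: $\mathcal{T}_\alpha(\mathcal{F},\mathcal{V})=\mathcal{V}_\alpha\cup\{f(t_1,\dots,t_n)\mid f:\alpha_1\times\cdots\times\alpha_n\to\alpha,\ t_i\in\mathcal{T}_{\beta_i}(\mathcal{F},\mathcal{V}),\ \alpha_i\succeq\beta_i\}$ and $\mathcal{T}_{\mathcal{S}}(\mathcal{F},\mathcal{V})=\bigcup_{\alpha\in S}\mathcal{T}_\alpha(\mathcal{F},\mathcal{V})$. A term $t$ is strictly order-sorted if, for all $p\in\mathrm{Pos}_{\mathcal{F}}(t)$, $\mathrm{root}(t|_p):\alpha_1\times\cdots\times\alpha_n\to\alpha$ and $t|_{pi}\in\mathcal{V}_\beta$ imply $\alpha_i=\beta$. $\mathcal{R}$ is compatible with $\mathcal{S}$ if, for every rule $\ell\to r$ with $\ell\in\mathcal{T}_\alpha(\mathcal{F},\mathcal{V})$ and $r\in\mathcal{T}_\beta(\mathcal{F},\mathcal{V})$,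 we have $\alpha\succeq\beta$ and $\ell$ is strictly order-sorted. Rewriting is on unsorted terms $\mathcal{T}(\mathcal{F},\mathcal{V})$. Confluent on a set $T$ means $T$ is closed under $\to_{\mathcal{R}}$ and $\to_{\mathcal{R}}$ restricted to $T$ is confluent. *)

theory Defs
  imports "HOL-Library.Confluence" "HOL-Library.Countable_Set"
begin

text \<open>
  Conventions. A signature is a set \<open>F\<close> of function symbols with an arity function \<open>ar\<close>; \<open>V\<close> is the
  set of variables. The datatype below contains raw terms; only the elements of \<open>terms F ar V\<close> are
  the (unsorted) terms over \<open>F\<close> and \<open>V\<close>. Argument positions are counted from \<open>0\<close>.
\<close>

datatype ('f, 'v) trm = Var 'v | Fun 'f "('f, 'v) trm list"

inductive_set terms :: "'f set \<Rightarrow> ('f \<Rightarrow> nat) \<Rightarrow> 'v set \<Rightarrow> ('f, 'v) trm set"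
  for F ar V where
  Var: "x \<in> V \<Longrightarrow> Var x \<in> terms F ar V"
| Fun: "f \<in> F \<Longrightarrow> length ts = ar f \<Longrightarrow> \<forall>t \<in> set ts. t \<in> terms F ar V \<Longrightarrow> Fun f ts \<in> terms F ar V"

fun vars :: "('f, 'v) trm \<Rightarrow> 'v set" where
  "vars (Var x) = {x}"
| "vars (Fun f ts) = (\<Union>t \<in> set ts. vars t)"

lemma size_nth_less [termination_simp]:
  "i < length ts \<Longrightarrow> size (ts ! i) < Suc (size_list size ts)"
  using size_list_estimation'[of "ts ! i" ts "size (ts ! i)" size] by (simp add: less_Suc_eq_le)

fun poss :: "('f, 'v) trm \<Rightarrow> nat list set" where
  "poss (Var x) = {[]}"
| "poss (Fun f ts) = {[]} \<union> (\<Union>i < length ts. (#) i ` poss (ts ! i))"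

text \<open>The subterm at a position; relevant only for positions in \<open>poss t\<close>.\<close>

fun subt_at :: "('f, 'v) trm \<Rightarrow> nat list \<Rightarrow> ('f, 'v) trm" where
  "subt_at t [] = t"
| "subt_at (Fun f ts) (i # p) = subt_at (ts ! i) p"
| "subt_at (Var x) (i # p) = undefined"

fun subst :: "('f, 'v) trm \<Rightarrow> ('v \<Rightarrow> ('f, 'v) trm) \<Rightarrow> ('f, 'v) trm" where
  "subst (Var x) \<sigma> = \<sigma> x"
| "subst (Fun f ts) \<sigma> = Fun f (map (\<lambda>t. subst t \<sigma>) ts)"

datatype ('f, 'v) ctxt =
  Hole | More 'f "('f, 'v) trm list" "('f, 'v) ctxt" "('f, 'v) trm list"

fun fill :: "('f, 'v) ctxt \<Rightarrow> ('f, 'v) trm \<Rightarrow> ('f, 'v) trm" where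
  "fill Hole t = t"
| "fill (More f us C vs) t = Fun f (us @ fill C t # vs)"

type_synonym ('f, 'v) rules = "(('f, 'v) trm \<times> ('f, 'v) trm) set"

definition trs :: "'f set \<Rightarrow> ('f \<Rightarrow> nat) \<Rightarrow> 'v set \<Rightarrow> ('f, 'v) rules \<Rightarrow> bool" where
  "trs F ar V R \<longleftrightarrow>
     (\<forall>(l, r) \<in> R. l \<in> terms F ar V \<and> r \<in> terms F ar V \<and> (\<nexists>x. l = Var x) \<and> vars r \<subseteq> vars l)"

definition rstep :: "'f set \<Rightarrow> ('f \<Rightarrow> nat) \<Rightarrow> 'v set \<Rightarrow> ('f, 'v) rules
    \<Rightarrow> ('f, 'v) trm \<Rightarrow> ('f, 'v) trm \<Rightarrow> bool" where
  "rstep F ar V R s t \<longleftrightarrow> s \<in> terms F ar V \<and> t \<in> terms F ar V \<and>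
     (\<exists>l r C \<sigma>. (l, r) \<in> R \<and> s = fill C (subst l \<sigma>) \<and> t = fill C (subst r \<sigma>))"

definition confluent_on :: "('a \<Rightarrow> 'a \<Rightarrow> bool) \<Rightarrow> 'a set \<Rightarrow> bool" where
  "confluent_on step T \<longleftrightarrow>
     (\<forall>s t. s \<in> T \<longrightarrow> step s t \<longrightarrow> t \<in> T) \<and>
     confluentp (\<lambda>s t. s \<in> T \<and> t \<in> T \<and> step s t)"

definition linear :: "('f, 'v) trm \<Rightarrow> bool" where
  "linear t \<longleftrightarrow>
     (\<forall>p \<in> poss t. \<forall>q \<in> poss t. \<forall>x. subt_at t p = Var x \<and> subt_at t q = Var x \<longrightarrow> p = q)"

definition left_linear :: "('f, 'v) rules \<Rightarrow> bool" where
  "left_linear R \<longleftrightarrow> (\<forall>(l, r) \<in> R. linear l)"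

definition precedence :: "'s set \<Rightarrow> ('s \<Rightarrow> 's \<Rightarrow> bool) \<Rightarrow> bool" where
  "precedence S gt \<longleftrightarrow> irreflp_on S gt \<and> transp_on S gt"

definition vars_of_sort :: "'v set \<Rightarrow> ('v \<Rightarrow> 's) \<Rightarrow> 's \<Rightarrow> 'v set" where
  "vars_of_sort V vsort \<alpha> = {x \<in> V. vsort x = \<alpha>}"

text \<open>
  A sort attachment is given by a map \<open>ty\<close>, where \<open>ty f = ([\<alpha>\<^sub>1, \<dots>, \<alpha>\<^sub>n], \<alpha>)\<close> stands for
  \<open>f : \<alpha>\<^sub>1 \<times> \<dots> \<times> \<alpha>\<^sub>n \<rightarrow> \<alpha>\<close>, and a map \<open>vsort\<close> giving the sorts of the variables.
\<close>

definition sort_attachment :: "'f set \<Rightarrow> ('f \<Rightarrow> nat) \<Rightarrow> 'v set \<Rightarrow> 's set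
    \<Rightarrow> ('f \<Rightarrow> 's list \<times> 's) \<Rightarrow> ('v \<Rightarrow> 's) \<Rightarrow> bool" where
  "sort_attachment F ar V S ty vsort \<longleftrightarrow>
     (\<forall>f \<in> F. \<forall>\<alpha>s \<alpha>. ty f = (\<alpha>s, \<alpha>) \<longrightarrow> length \<alpha>s = ar f \<and> set \<alpha>s \<subseteq> S \<and> \<alpha> \<in> S) \<and>
     (\<forall>x \<in> V. vsort x \<in> S) \<and>
     (\<forall>\<alpha> \<in> S. countable (vars_of_sort V vsort \<alpha>) \<and> infinite (vars_of_sort V vsort \<alpha>))"

inductive has_sort :: "'f set \<Rightarrow> 'v set \<Rightarrow> ('s \<Rightarrow> 's \<Rightarrow> bool) \<Rightarrow> ('f \<Rightarrow> 's list \<times> 's) \<Rightarrow> ('v \<Rightarrow> 's)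
    \<Rightarrow> ('f, 'v) trm \<Rightarrow> 's \<Rightarrow> bool"
  for F V gt ty vsort where
  Var: "x \<in> vars_of_sort V vsort \<alpha> \<Longrightarrow> has_sort F V gt ty vsort (Var x) \<alpha>"
| Fun: "f \<in> F \<Longrightarrow> ty f = (\<alpha>s, \<alpha>) \<Longrightarrow> length ts = length \<alpha>s \<Longrightarrow>
    \<forall>i < length ts. \<exists>\<beta>. gt\<^sup>=\<^sup>= (\<alpha>s ! i) \<beta> \<and> has_sort F V gt ty vsort (ts ! i) \<beta> \<Longrightarrow>
    has_sort F V gt ty vsort (Fun f ts) \<alpha>"

definition terms_of_sort :: "'f set \<Rightarrow> 'v set \<Rightarrow> ('s \<Rightarrow> 's \<Rightarrow> bool) \<Rightarrow> ('f \<Rightarrow> 's list \<times> 's)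
    \<Rightarrow> ('v \<Rightarrow> 's) \<Rightarrow> 's \<Rightarrow> ('f, 'v) trm set" where
  "terms_of_sort F V gt ty vsort \<alpha> = {t. has_sort F V gt ty vsort t \<alpha>}"

definition order_sorted_terms :: "'f set \<Rightarrow> 'v set \<Rightarrow> 's set \<Rightarrow> ('s \<Rightarrow> 's \<Rightarrow> bool)
    \<Rightarrow> ('f \<Rightarrow> 's list \<times> 's) \<Rightarrow> ('v \<Rightarrow> 's) \<Rightarrow> ('f, 'v) trm set" where
  "order_sorted_terms F V S gt ty vsort = (\<Union>\<alpha> \<in> S. terms_of_sort F V gt ty vsort \<alpha>)"

definition strictly_order_sorted :: "'v set \<Rightarrow> ('f \<Rightarrow> 's list \<times> 's) \<Rightarrow> ('v \<Rightarrow> 's)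
    \<Rightarrow> ('f, 'v) trm \<Rightarrow> bool" where
  "strictly_order_sorted V ty vsort t \<longleftrightarrow>
     (\<forall>p \<in> poss t. \<forall>f ts \<alpha>s \<alpha> i \<beta>.
        subt_at t p = Fun f ts \<and> ty f = (\<alpha>s, \<alpha>) \<and> p @ [i] \<in> poss t \<and>
        subt_at t (p @ [i]) \<in> Var ` vars_of_sort V vsort \<beta> \<longrightarrow> \<alpha>s ! i = \<beta>)"

text \<open>
  Compatibility includes that both sides of every rule are order-sorted, i.e. the sorts of
  the two sides are asserted to exist.
\<close>

definition compatible :: "'f set \<Rightarrow> 'v set \<Rightarrow> 's set \<Rightarrow> ('s \<Rightarrow> 's \<Rightarrow> bool)
    \<Rightarrow> ('f \<Rightarrow> 's list \<times> 's) \<Rightarrow> ('v \<Rightarrow> 's) \<Rightarrow> ('f, 'v) rules \<Rightarrow> bool" where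
  "compatible F V S gt ty vsort R \<longleftrightarrow>
     (\<forall>(l, r) \<in> R. \<exists>\<alpha> \<in> S. \<exists>\<beta> \<in> S.
        l \<in> terms_of_sort F V gt ty vsort \<alpha> \<and> r \<in> terms_of_sort F V gt ty vsort \<beta> \<and>
        gt\<^sup>=\<^sup>= \<alpha> \<beta> \<and> strictly_order_sorted V ty vsort l)"

end

theory Submission
  imports Defs
begin

text \<open>
  An argument clashes with its slot if its sort is not below the sort expected there. The rank of a
  term is the maximal number of clashes on a path; it is \<open>0\<close> exactly for the order-sorted terms, and
  compatibility makes it non-increasing under rewriting. Confluence of the terms of rank at most \<open>n\<close>
  is shown by induction on \<open>n\<close>.

  For rank \<open>n + 1\<close>, the tall aliens are the clashing subterms of rank at least \<open>n\<close>. No rule overlaps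
  with the border of a tall alien, so every step is either inner (inside of a tall alien) or outer.
  Replacing the tall aliens by fresh variables of the expected sorts leaves a term of rank at most \<open>n\<close>
  and, by left-linearity, preserves all outer steps; so outer steps are confluent by the induction
  hypothesis, as are the steps inside a single tall alien. An alien may fuse with the layer above it when
  it is rewritten or moved. It is no longer tall then, and steps in it have become outer.
  Hence peaks of inner steps, and peaks of an inner and an outer step, can be closed by inner steps
  followed by outer ones, with outer steps alone on the inner side of a mixed peak, and this suffices
  for confluence.
\<close>

section \<open>Reduction sequences on lists, fresh choices and a confluence criterion\<close>

text \<open>Components are rewritten from left to right: after \<open>k\<close> rounds the list is
  \<open>take k ys @ drop k xs\<close>. With \<open>g\<close> and \<open>Q\<close> general, this
  serves both plain rewriting and outer steps below a function symbol.\<close>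

lemma rtranclp_update_all:
  assumes step: "\<And>xs i y. length xs = m \<Longrightarrow> i < m \<Longrightarrow> P i (xs ! i) y \<Longrightarrow> Q (g xs) (g (xs[i := y]))"
    and len: "length xs = m" "length ys = m"
    and steps: "\<And>i. i < m \<Longrightarrow> (P i)\<^sup>*\<^sup>* (xs ! i) (ys ! i)"
  shows "Q\<^sup>*\<^sup>* (g xs) (g ys)"
proof -
  have single: "Q\<^sup>*\<^sup>* (g zs) (g (zs[i := y]))"
    if "length zs = m" "i < m" "(P i)\<^sup>*\<^sup>* (zs ! i) y" for zs i y
    using that(3)
  proof (induction rule: rtranclp_induct)
    case base
    then show ?case by simp
  next
    case (step y z)
    have "Q (g (zs[i := y])) (g (zs[i := y, i := z]))"
      using that step.hyps by (intro assms(1)) auto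
    with step.IH show ?case by simp
  qed
  have "Q\<^sup>*\<^sup>* (g xs) (g (take k ys @ drop k xs))" if "k \<le> m" for k
    using that
  proof (induction k)
    case 0
    then show ?case by simp
  next
    case (Suc k)
    let ?zs = "take k ys @ drop k xs"
    have "Q\<^sup>*\<^sup>* (g ?zs) (g (?zs[k := ys ! k]))"
      using Suc.prems len steps[of k] by (intro single) (auto simp: nth_append)
    moreover have "?zs[k := ys ! k] = take (Suc k) ys @ drop (Suc k) xs"
      using Suc.prems len
      by (auto intro!: nth_equalityI simp: nth_append nth_list_update less_Suc_eq)
    ultimately show ?case using Suc by auto
  qed
  from this[of m] len show ?thesis by simp
qed

text \<open>Values are chosen one after another, avoiding the finitely many already taken. This
  supplies distinct fresh variables of prescribed sorts.\<close>

lemma ex_inj_choice: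
  assumes "finite D" "\<And>d. d \<in> D \<Longrightarrow> infinite (A d)"
  shows "\<exists>c. inj_on c D \<and> (\<forall>d\<in>D. c d \<in> A d)"
  using assms
proof (induction D)
  case empty
  then show ?case by simp
next
  case (insert d D)
  then obtain c where c: "inj_on c D" "\<forall>d\<in>D. c d \<in> A d" by blast
  have "infinite (A d - c ` D)" using insert by simp
  then obtain x where x: "x \<in> A d" "x \<notin> c ` D"
    using not_finite_existsD by (metis Diff_iff finite.emptyI ex_in_conv)
  have "inj_on (c(d := x)) (insert d D)"
    using c x insert.hyps by (auto simp: inj_on_def)
  moreover have "\<forall>d'\<in>insert d D. (c(d := x)) d' \<in> A d'" using c x by auto
  ultimately show ?case by blast
qed

text \<open>An instance of the decreasing diagrams method with two labels, \<open>S\<close> being below \<open>T\<close>.\<close>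

lemma confluence_by_two_labels:
  assumes SS: "\<And>s a b. S\<^sup>*\<^sup>* s a \<Longrightarrow> S\<^sup>*\<^sup>* s b \<Longrightarrow> \<exists>u. S\<^sup>*\<^sup>* a u \<and> S\<^sup>*\<^sup>* b u"
    and TT: "\<And>s a b. T s a \<Longrightarrow> T s b \<Longrightarrow> \<exists>u. (T OO S\<^sup>*\<^sup>*) a u \<and> (T OO S\<^sup>*\<^sup>*) b u"
    and ST: "\<And>s a b. S s a \<Longrightarrow> T s b \<Longrightarrow> \<exists>u. (T OO S\<^sup>*\<^sup>*) a u \<and> S\<^sup>*\<^sup>* b u"
    and sub: "\<And>s t. A s t \<Longrightarrow> (T OO S\<^sup>*\<^sup>*) s t"
    and sup: "\<And>s t. S s t \<Longrightarrow> A\<^sup>*\<^sup>* s t" "\<And>s t. T s t \<Longrightarrow> A\<^sup>*\<^sup>* s t"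
    and "A\<^sup>*\<^sup>* s a" "A\<^sup>*\<^sup>* s b"
  shows "\<exists>u. A\<^sup>*\<^sup>* a u \<and> A\<^sup>*\<^sup>* b u"
proof -
  define Q where "Q = T OO S\<^sup>*\<^sup>*"
  note sub = sub[folded Q_def] and TT = TT[folded Q_def] and ST = ST[folded Q_def]
  have sub_star: "Q\<^sup>*\<^sup>* x y" if "A\<^sup>*\<^sup>* x y" for x y
    using that by (induction rule: rtranclp_induct) (auto intro: rtranclp.rtrancl_into_rtrancl dest: sub)
  have QI: "Q x z" if "T x y" "S\<^sup>*\<^sup>* y z" for x y z
    using that by (auto simp: Q_def)
  have QE: thesis if "Q x z" "\<And>y. T x y \<Longrightarrow> S\<^sup>*\<^sup>* y z \<Longrightarrow> thesis" for x z thesis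
    using that by (auto simp: Q_def)
  have QS: "Q x z" if "Q x y" "S\<^sup>*\<^sup>* y z" for x y z
    using that by (auto elim!: QE intro: QI rtranclp_trans)
  have S_A: "A\<^sup>*\<^sup>* x y" if "S\<^sup>*\<^sup>* x y" for x y
    using that by (induction rule: rtranclp_induct) (auto dest: sup(1))
  have Q_A: "A\<^sup>*\<^sup>* x y" if "Q x y" for x y
    using that by (auto elim!: QE intro: rtranclp_trans[OF sup(2) S_A])
  \<comment> \<open>\<open>ST\<close> returns a single \<open>T\<close> step on the \<open>S\<close>
    side, so it can be pushed along a whole \<open>S\<close> sequence; the \<open>S\<close> tails
    that pile up are joined by \<open>SS\<close>.\<close>
  have ST': "\<exists>u. Q x u \<and> S\<^sup>*\<^sup>* y u" if "S\<^sup>*\<^sup>* z x" "T z y" for x y z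
    using that
  proof (induction arbitrary: y rule: converse_rtranclp_induct)
    case base
    then show ?case using QI by blast
  next
    case (step z z')
    from ST[OF step.hyps(1) step.prems]
    obtain u c where u: "T z' c" "S\<^sup>*\<^sup>* c u" "S\<^sup>*\<^sup>* y u" by (blast elim: QE)
    from step.IH[OF u(1)] obtain v where v: "Q x v" "S\<^sup>*\<^sup>* c v" by blast
    from SS[OF u(2) v(2)] obtain d where "S\<^sup>*\<^sup>* u d" "S\<^sup>*\<^sup>* v d" by blast
    with u v QS show ?case by (meson rtranclp_trans)
  qed
  \<comment> \<open>The peak of the two leading \<open>T\<close> steps is closed first.
    \<open>ST'\<close> then carries the closing steps past the \<open>S\<close> tails, and three
    applications of \<open>SS\<close> join the ends.\<close>
  have diamond: "\<exists>u. Q x u \<and> Q y u" if xy: "Q z x" "Q z y" for x y z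
  proof -
    from xy obtain x' y' where 1: "T z x'" "S\<^sup>*\<^sup>* x' x" "T z y'" "S\<^sup>*\<^sup>* y' y" by (blast elim: QE)
    from TT[OF 1(1) 1(3)] obtain u p q
      where 2: "T x' p" "S\<^sup>*\<^sup>* p u" "T y' q" "S\<^sup>*\<^sup>* q u" by (blast elim: QE)
    from ST'[OF 1(2) 2(1)] obtain v where v: "Q x v" "S\<^sup>*\<^sup>* p v" by blast
    from ST'[OF 1(4) 2(3)] obtain w where w: "Q y w" "S\<^sup>*\<^sup>* q w" by blast
    from SS[OF v(2) 2(2)] obtain v' where v': "S\<^sup>*\<^sup>* v v'" "S\<^sup>*\<^sup>* u v'" by blast
    from SS[OF w(2) 2(4)] obtain w' where w': "S\<^sup>*\<^sup>* w w'" "S\<^sup>*\<^sup>* u w'" by blast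
    from SS[OF v'(2) w'(2)] obtain d where "S\<^sup>*\<^sup>* v' d" "S\<^sup>*\<^sup>* w' d" by blast
    with v w v' w' QS show ?thesis by meson
  qed
  have "strong_confluentp Q"
  proof (rule strong_confluentpI)
    fix x y z assume "Q x y" "Q x z"
    from diamond[OF this] obtain u where "Q y u" "Q z u" by blast
    then show "\<exists>u. Q\<^sup>*\<^sup>* y u \<and> Q\<^sup>=\<^sup>= z u"
      by (intro exI[of _ u] conjI r_into_rtranclp sup2CI) simp_all
  qed
  then have "confluentp Q" by (rule strong_confluentp_imp_confluentp)
  moreover have "Q\<^sup>*\<^sup>* s a" "Q\<^sup>*\<^sup>* s b"
    by (rule sub_star, fact)+
  ultimately obtain u where "Q\<^sup>*\<^sup>* a u" "Q\<^sup>*\<^sup>* b u"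
    by (meson confluentpD)
  moreover have "A\<^sup>*\<^sup>* x y" if "Q\<^sup>*\<^sup>* x y" for x y
    using that by (induction rule: rtranclp_induct) (auto dest: Q_A)
  ultimately show ?thesis by blast
qed

subsection \<open>Terms and rewriting\<close>

text \<open>A recursive counterpart of \<open>strictly_order_sorted\<close>, so that structural
  induction on left-hand sides applies. The sort of a variable is read off \<open>vsort\<close>,
  which agrees with \<open>vars_of_sort\<close> for the variables in \<open>V\<close>.\<close>

fun strict :: "('f \<Rightarrow> 's list \<times> 's) \<Rightarrow> ('v \<Rightarrow> 's) \<Rightarrow> ('f, 'v) trm \<Rightarrow> bool" where
  "strict ty vsort (Var x) \<longleftrightarrow> True"
| "strict ty vsort (Fun f ts) \<longleftrightarrow> (\<forall>i < length ts. strict ty vsort (ts ! i) \<and>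
     (\<forall>x. ts ! i = Var x \<longrightarrow> fst (ty f) ! i = vsort x))"

lemma strictly_order_sorted_imp_strict:
  "t \<in> terms F ar V \<Longrightarrow> strictly_order_sorted V ty vsort t \<Longrightarrow> strict ty vsort t"
proof (induction rule: terms.induct)
  case (Var x)
  then show ?case by simp
next
  case (Fun f ts)
  show ?case unfolding strict.simps
  proof (intro allI impI conjI)
    fix i assume i: "i < length ts"
    then have ti: "ts ! i \<in> set ts" by simp
    have "strictly_order_sorted V ty vsort (ts ! i)"
      unfolding strictly_order_sorted_def
    proof (intro ballI allI impI)
      fix p g us \<alpha>s \<alpha> j \<beta>
      assume p: "p \<in> poss (ts ! i)" and *: "subt_at (ts ! i) p = Fun g us \<and> ty g = (\<alpha>s, \<alpha>) \<and>
        p @ [j] \<in> poss (ts ! i) \<and> subt_at (ts ! i) (p @ [j]) \<in> Var ` vars_of_sort V vsort \<beta>"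
      have "i # p \<in> poss (Fun f ts)" using p i by auto
      moreover have "(i # p) @ [j] \<in> poss (Fun f ts)" using * i by auto
      ultimately show "\<alpha>s ! j = \<beta>"
        using * Fun.prems[unfolded strictly_order_sorted_def, rule_format, of "i # p" g us \<alpha>s \<alpha> j \<beta>]
        by simp
    qed
    with Fun.IH ti show "strict ty vsort (ts ! i)" by blast
    fix x assume x: "ts ! i = Var x"
    have "x \<in> V" using Fun.IH ti x by (metis terms.cases trm.distinct(1) trm.inject(1))
    moreover have "[i] \<in> poss (Fun f ts)" using i x by force
    moreover obtain \<alpha>s \<alpha> where "ty f = (\<alpha>s, \<alpha>)" by fastforce
    ultimately show "fst (ty f) ! i = vsort x"
      using x Fun.prems[unfolded strictly_order_sorted_def, rule_format, of "[]" f ts \<alpha>s \<alpha> i "vsort x"]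
      by (simp add: vars_of_sort_def)
  qed
qed

lemma vars_poss: "x \<in> vars t \<Longrightarrow> \<exists>p \<in> poss t. subt_at t p = Var x"
proof (induction t)
  case (Var y)
  then show ?case by simp
next
  case (Fun f ts)
  then obtain t where "t \<in> set ts" "x \<in> vars t" by auto
  with Fun.IH obtain p i where "i < length ts" "p \<in> poss (ts ! i)" "subt_at (ts ! i) p = Var x"
    by (metis in_set_conv_nth)
  then show ?case by (intro bexI[of _ "i # p"]) auto
qed

lemma linear_Fun_nth:
  assumes "linear (Fun f ts)" "i < length ts"
  shows "linear (ts ! i)"
  unfolding linear_def
proof (intro ballI allI impI)
  fix p q x
  assume "p \<in> poss (ts ! i)" "q \<in> poss (ts ! i)" "subt_at (ts ! i) p = Var x \<and> subt_at (ts ! i) q = Var x"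
  with assms(2) assms(1)[unfolded linear_def, rule_format, of "i # p" "i # q" x]
  show "p = q" by auto
qed

text \<open>A shared variable gives positions \<open>i # p\<close> and \<open>j # q\<close>, which
  linearity identifies. Substitutions found separately for the arguments can therefore be
  combined.\<close>

lemma linear_Fun_disjoint:
  assumes "linear (Fun f ts)" "i < length ts" "j < length ts" "x \<in> vars (ts ! i)" "x \<in> vars (ts ! j)"
  shows "i = j"
proof -
  from vars_poss[OF assms(4)] vars_poss[OF assms(5)] obtain p q
    where "p \<in> poss (ts ! i)" "subt_at (ts ! i) p = Var x"
      "q \<in> poss (ts ! j)" "subt_at (ts ! j) q = Var x" by blast
  with assms(2,3) assms(1)[unfolded linear_def, rule_format, of "i # p" "j # q" x]
  show ?thesis by auto
qed

lemma subst_cong: "(\<And>x. x \<in> vars t \<Longrightarrow> \<sigma> x = \<tau> x) \<Longrightarrow> subst t \<sigma> = subst t \<tau>"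
  by (induction t) auto

lemma subst_ident: "(\<And>x. x \<in> vars t \<Longrightarrow> \<sigma> x = Var x) \<Longrightarrow> subst t \<sigma> = t"
  by (induction t) (auto intro: map_idI)

lemma subst_subst: "subst (subst t \<sigma>) \<tau> = subst t (\<lambda>x. subst (\<sigma> x) \<tau>)"
  by (induction t) auto

lemma finite_vars: "finite (vars t)"
  by (induction t) auto

lemma terms_Fun_iff:
  "Fun f ts \<in> terms F ar V \<longleftrightarrow> f \<in> F \<and> length ts = ar f \<and> (\<forall>i < length ts. ts ! i \<in> terms F ar V)"
  by (subst terms.simps) (auto simp: all_set_conv_all_nth)

lemma terms_Var_iff: "Var x \<in> terms F ar V \<longleftrightarrow> x \<in> V"
  by (subst terms.simps) auto

lemma subst_in_terms:
  "t \<in> terms F ar V \<Longrightarrow> (\<And>x. x \<in> vars t \<Longrightarrow> \<sigma> x \<in> terms F ar V) \<Longrightarrow> subst t \<sigma> \<in> terms F ar V"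
proof (induction rule: terms.induct)
  case (Fun f ts)
  have "\<forall>t\<in>set (map (\<lambda>t. subst t \<sigma>) ts). t \<in> terms F ar V"
    using Fun.IH Fun.prems by auto
  with Fun.IH Fun.hyps show ?case unfolding subst.simps by (intro terms.Fun) auto
qed simp

lemma vars_subst_in_terms: "subst t \<sigma> \<in> terms F ar V \<Longrightarrow> x \<in> vars t \<Longrightarrow> \<sigma> x \<in> terms F ar V"
proof (induction t)
  case (Fun f ts)
  then show ?case by (force simp: terms_Fun_iff in_set_conv_nth)
qed simp

text \<open>Redexes are located by descent into arguments instead of by contexts, and membership in
  \<open>terms\<close> is kept apart, so that rule induction follows the term structure.\<close>

inductive rewr :: "('f, 'v) rules \<Rightarrow> ('f, 'v) trm \<Rightarrow> ('f, 'v) trm \<Rightarrow> bool" for R where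
  root: "(l, r) \<in> R \<Longrightarrow> rewr R (subst l \<sigma>) (subst r \<sigma>)"
| arg: "i < length ss \<Longrightarrow> rewr R (ss ! i) t \<Longrightarrow> rewr R (Fun f ss) (Fun f (ss[i := t]))"

lemma rewr_fill: "rewr R s t \<Longrightarrow> rewr R (fill C s) (fill C t)"
proof (induction C)
  case (More f us C vs)
  then have "rewr R (Fun f (us @ fill C s # vs)) (Fun f ((us @ fill C s # vs)[length us := fill C t]))"
    by (intro rewr.arg) auto
  then show ?case by simp
qed simp

lemma rewr_imp_fill:
  "rewr R s t \<Longrightarrow> \<exists>l r C \<sigma>. (l, r) \<in> R \<and> s = fill C (subst l \<sigma>) \<and> t = fill C (subst r \<sigma>)"
proof (induction rule: rewr.induct)
  case (root l r \<sigma>)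
  then show ?case by (intro exI[of _ l] exI[of _ r] exI[of _ Hole] exI[of _ \<sigma>]) simp
next
  case (arg i ss t f)
  then obtain l r C \<sigma> where lr: "(l, r) \<in> R"
    and eqs: "ss ! i = fill C (subst l \<sigma>)" "t = fill C (subst r \<sigma>)" by blast
  let ?C = "More f (take i ss) C (drop (Suc i) ss)"
  from arg.hyps(1) have "Fun f ss = fill ?C (subst l \<sigma>)" "Fun f (ss[i := t]) = fill ?C (subst r \<sigma>)"
    by (simp_all add: id_take_nth_drop[symmetric] upd_conv_take_nth_drop flip: eqs)
  with lr show ?case by blast
qed

lemma rstep_iff_rewr:
  "rstep F ar V R s t \<longleftrightarrow> s \<in> terms F ar V \<and> t \<in> terms F ar V \<and> rewr R s t"
proof -
  have "rewr R s t" if "(l, r) \<in> R" "s = fill C (subst l \<sigma>)" "t = fill C (subst r \<sigma>)" for l r C \<sigma>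
    using rewr_fill[OF rewr.root[OF that(1)]] that(2,3) by simp
  then show ?thesis unfolding rstep_def by (blast dest: rewr_imp_fill)
qed

lemma rewrs_Fun:
  assumes "length ss = length ts" "\<And>i. i < length ss \<Longrightarrow> (rewr R)\<^sup>*\<^sup>* (ss ! i) (ts ! i)"
  shows "(rewr R)\<^sup>*\<^sup>* (Fun f ss) (Fun f ts)"
proof (rule rtranclp_update_all[where P = "\<lambda>_. rewr R" and g = "Fun f"])
  fix xs :: "('a, 'b) trm list" and i y
  assume "length xs = length ss" "i < length ss" "rewr R (xs ! i) y"
  then show "rewr R (Fun f xs) (Fun f (xs[i := y]))" by (simp add: rewr.arg)
qed (use assms in auto)


subsection \<open>Sort clashes and the rank\<close>

text \<open>Confluence on the order-sorted terms enters later, as the start of the induction on the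
  rank.\<close>

locale order_sorted_trs =
  fixes F :: "'f set" and ar :: "'f \<Rightarrow> nat" and V :: "'v set"
    and S :: "'s set" and gt :: "'s \<Rightarrow> 's \<Rightarrow> bool"
    and ty :: "'f \<Rightarrow> 's list \<times> 's" and vsort :: "'v \<Rightarrow> 's"
    and R :: "('f, 'v) rules"
  assumes precedence: "precedence S gt"
    and sort_attachment: "sort_attachment F ar V S ty vsort"
    and trs: "trs F ar V R"
    and compatible: "compatible F V S gt ty vsort R"
    and left_linear: "left_linear R"
begin

abbreviation "Terms \<equiv> terms F ar V"

abbreviation "arg_sort f i \<equiv> fst (ty f) ! i"

fun sort_of :: "('f, 'v) trm \<Rightarrow> 's" where
  "sort_of (Var x) = vsort x"
| "sort_of (Fun f ts) = snd (ty f)"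

text \<open>
  Terms are considered in a slot: \<open>Some \<beta>\<close> stands for an argument position of sort \<open>\<beta>\<close>, and \<open>None\<close> for
  the position of the whole term, where every sort is admitted.
\<close>

fun clash :: "'s option \<Rightarrow> ('f, 'v) trm \<Rightarrow> bool" where
  "clash None t \<longleftrightarrow> False"
| "clash (Some \<beta>) t \<longleftrightarrow> \<not> gt\<^sup>=\<^sup>= \<beta> (sort_of t)"

text \<open>Sorts are restricted to \<open>S\<close> because \<open>gt\<close> is assumed to be
  transitive on \<open>S\<close> only.\<close>

definition slots :: "'s option set" where
  "slots = insert None (Some ` S)"

text \<open>Clashes are counted strictly below the root; \<open>insert 0\<close> covers constants.
  The weight \<open>w x\<close> lets a variable stand for a hidden subterm that contributes
  \<open>w x\<close> further clashes.\<close>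

fun rank :: "('v \<Rightarrow> nat) \<Rightarrow> ('f, 'v) trm \<Rightarrow> nat" where
  "rank w (Var x) = w x"
| "rank w (Fun f ts) = Max (insert 0
     ((\<lambda>i. rank w (ts ! i) + of_bool (clash (Some (arg_sort f i)) (ts ! i))) ` {..<length ts}))"

abbreviation rank0 :: "('f, 'v) trm \<Rightarrow> nat" where
  "rank0 \<equiv> rank (\<lambda>_. 0)"

definition slot_rank :: "('v \<Rightarrow> nat) \<Rightarrow> 's option \<Rightarrow> ('f, 'v) trm \<Rightarrow> nat" where
  "slot_rank w b t = rank w t + of_bool (clash b t)"

lemma clash_Fun: "clash b (Fun f ss) \<longleftrightarrow> clash b (Fun f ts)"
  by (cases b) auto

lemma slot_rank_None [simp]: "slot_rank w None t = rank w t"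
  by (simp add: slot_rank_def)

lemma rank_le_slot_rank: "rank w t \<le> slot_rank w b t"
  by (simp add: slot_rank_def)

lemma rank_Fun_le:
  "rank w (Fun f ts) \<le> k \<longleftrightarrow> (\<forall>i < length ts. slot_rank w (Some (arg_sort f i)) (ts ! i) \<le> k)"
  by (auto simp: slot_rank_def)

declare rank.simps(2) [simp del]

lemma slot_rank_arg_le:
  "i < length ts \<Longrightarrow> slot_rank w (Some (arg_sort f i)) (ts ! i) \<le> rank w (Fun f ts)"
  using rank_Fun_le by blast

lemma rank_cong: "(\<And>x. x \<in> vars t \<Longrightarrow> w x = w' x) \<Longrightarrow> rank w t = rank w' t"
proof (induction t)
  case (Fun f ts)
  have "rank w (ts ! i) = rank w' (ts ! i)" if "i < length ts" for i
    using nth_mem[OF that] Fun.prems by (intro Fun.IH) auto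
  then show ?case by (auto simp: rank.simps(2) simp del: clash.simps cong: image_cong_simp)
qed simp

lemma weight_le_rank: "x \<in> vars t \<Longrightarrow> w x \<le> rank w t"
proof (induction t)
  case (Fun f ts)
  then obtain i where i: "i < length ts" "x \<in> vars (ts ! i)" by (auto simp: in_set_conv_nth)
  with Fun.IH have "w x \<le> rank w (ts ! i)" by simp
  then show ?case
    using slot_rank_arg_le[OF i(1), of w f] rank_le_slot_rank[of w "ts ! i" "Some (arg_sort f i)"] by linarith
qed simp

lemma rank0_le: "rank0 t \<le> rank w t"
proof (induction t)
  case (Fun f ts)
  show ?case unfolding rank_Fun_le
  proof (intro allI impI)
    fix i assume i: "i < length ts"
    then have "slot_rank (\<lambda>_. 0) (Some (arg_sort f i)) (ts ! i) \<le> slot_rank w (Some (arg_sort f i)) (ts ! i)"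
      using Fun by (simp add: slot_rank_def)
    also have "\<dots> \<le> rank w (Fun f ts)" using i by (rule slot_rank_arg_le)
    finally show "slot_rank (\<lambda>_. 0) (Some (arg_sort f i)) (ts ! i) \<le> rank w (Fun f ts)" .
  qed
qed simp

lemma arg_sort_in: "f \<in> F \<Longrightarrow> i < ar f \<Longrightarrow> arg_sort f i \<in> S"
  using sort_attachment unfolding sort_attachment_def
  by (metis nth_mem prod.collapse subset_iff)

lemma slot_None [simp]: "None \<in> slots"
  by (simp add: slots_def)

lemma slot_arg: "Fun f ts \<in> Terms \<Longrightarrow> i < length ts \<Longrightarrow> Some (arg_sort f i) \<in> slots"
  using arg_sort_in by (auto simp: terms_Fun_iff slots_def)

lemma sort_of_in: "t \<in> Terms \<Longrightarrow> sort_of t \<in> S"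
  using sort_attachment unfolding sort_attachment_def
  by (cases t) (auto simp: terms_Fun_iff terms_Var_iff, metis prod.collapse)

lemma geq_trans:
  "gt\<^sup>=\<^sup>= \<alpha> \<beta> \<Longrightarrow> gt\<^sup>=\<^sup>= \<beta> \<gamma> \<Longrightarrow> \<alpha> \<in> S \<Longrightarrow> \<beta> \<in> S \<Longrightarrow> \<gamma> \<in> S \<Longrightarrow> gt\<^sup>=\<^sup>= \<alpha> \<gamma>"
  using transp_onD[of S gt \<alpha> \<beta> \<gamma>] precedence unfolding precedence_def by blast

lemma not_clash_trans:
  assumes "\<not> clash b s" "gt\<^sup>=\<^sup>= (sort_of s) (sort_of t)" "b \<in> slots" "s \<in> Terms" "t \<in> Terms"
  shows "\<not> clash b t"
  using assms geq_trans[of _ "sort_of s" "sort_of t"]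
  by (cases b) (auto simp: slots_def sort_of_in)

section \<open>Order-sorted terms as the terms of rank zero\<close>

lemma has_sort_imp: "has_sort F V gt ty vsort t \<alpha> \<Longrightarrow> sort_of t = \<alpha> \<and> rank0 t = 0"
proof (induction rule: has_sort.induct)
  case (Var x \<alpha>)
  then show ?case by (simp add: vars_of_sort_def)
next
  case (Fun f \<alpha>s \<alpha> ts)
  have "slot_rank (\<lambda>_. 0) (Some (arg_sort f i)) (ts ! i) \<le> 0" if "i < length ts" for i
    using Fun.IH Fun.hyps that by (auto simp: slot_rank_def)
  then have "rank0 (Fun f ts) \<le> 0" unfolding rank_Fun_le by blast
  with Fun.hyps show ?case by simp
qed

lemma rank0_imp_has_sort: "t \<in> Terms \<Longrightarrow> rank0 t = 0 \<Longrightarrow> has_sort F V gt ty vsort t (sort_of t)"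
proof (induction t rule: terms.induct)
  case (Var x)
  then show ?case by (auto intro: has_sort.Var simp: vars_of_sort_def)
next
  case (Fun f ts)
  obtain \<alpha>s \<alpha> where ty: "ty f = (\<alpha>s, \<alpha>)" by fastforce
  then have "length ts = length \<alpha>s"
    using Fun.hyps sort_attachment unfolding sort_attachment_def by metis
  moreover have "\<exists>\<beta>. gt\<^sup>=\<^sup>= (\<alpha>s ! i) \<beta> \<and> has_sort F V gt ty vsort (ts ! i) \<beta>" if i: "i < length ts" for i
  proof -
    have "slot_rank (\<lambda>_. 0) (Some (arg_sort f i)) (ts ! i) = 0"
      using slot_rank_arg_le[OF i, of "\<lambda>_. 0" f] Fun.prems by simp
    then show ?thesis
      using Fun.IH i ty by (intro exI[of _ "sort_of (ts ! i)"]) (auto simp: slot_rank_def)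
  qed
  ultimately show ?case using Fun.hyps ty by (auto intro: has_sort.Fun)
qed

lemma rank0_arg:
  assumes "rank0 (Fun f ts) = 0" "i < length ts"
  shows "rank0 (ts ! i) = 0" "\<not> clash (Some (arg_sort f i)) (ts ! i)"
  using slot_rank_arg_le[OF assms(2), of "\<lambda>_. 0" f] assms(1)
  by (auto simp: slot_rank_def simp del: clash.simps)

lemma rule_facts:
  assumes "(l, r) \<in> R"
  shows "l \<in> Terms" "r \<in> Terms" "l \<noteq> Var x" "vars r \<subseteq> vars l" "rank0 l = 0" "rank0 r = 0"
    "gt\<^sup>=\<^sup>= (sort_of l) (sort_of r)" "strict ty vsort l" "linear l"
proof -
  show *: "l \<in> Terms" "r \<in> Terms" "l \<noteq> Var x" "vars r \<subseteq> vars l"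
    using trs assms unfolding trs_def by auto
  from compatible assms obtain \<alpha> \<beta> where
    "has_sort F V gt ty vsort l \<alpha>" "has_sort F V gt ty vsort r \<beta>" "gt\<^sup>=\<^sup>= \<alpha> \<beta>"
    and strict: "strictly_order_sorted V ty vsort l"
    unfolding compatible_def terms_of_sort_def by fast
  with has_sort_imp show "rank0 l = 0" "rank0 r = 0" "gt\<^sup>=\<^sup>= (sort_of l) (sort_of r)" by auto
  show "strict ty vsort l" using strict *(1) by (rule strictly_order_sorted_imp_strict[rotated])
  show "linear l" using left_linear assms unfolding left_linear_def by auto
qed

lemma lhs_Fun:
  assumes "(l, r) \<in> R"
  obtains f ts where "l = Fun f ts"
  using rule_facts(3)[OF assms] by (cases l) auto

section \<open>Terms and rank bounds under rewriting\<close>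

lemma rewr_in_terms: "rewr R s t \<Longrightarrow> s \<in> Terms \<Longrightarrow> t \<in> Terms"
proof (induction rule: rewr.induct)
  case (root l r \<sigma>)
  then show ?case
    using rule_facts(2,4)[OF root.hyps] by (meson subsetD subst_in_terms vars_subst_in_terms)
next
  case (arg i ss t f)
  then show ?case by (auto simp: terms_Fun_iff nth_list_update)
qed

text \<open>An order-sorted \<open>u\<close> has no clashes of its own, so all of them come from the
  instances of its variables. A slot of \<open>u\<close> that admits \<open>y\<close> lies weakly
  above \<open>vsort y\<close>; by transitivity an instance that fits \<open>vsort y\<close> fits
  there as well.\<close>

lemma slot_rank_subst_le:
  assumes "u \<in> Terms" "rank0 u = 0" "b \<in> slots" "\<not> clash b u"
    and "\<And>y. y \<in> vars u \<Longrightarrow> \<sigma> y \<in> Terms \<and> slot_rank w (Some (vsort y)) (\<sigma> y) \<le> k"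
  shows "slot_rank w b (subst u \<sigma>) \<le> k"
  using assms
proof (induction u arbitrary: b rule: terms.induct)
  case (Var y)
  have "clash (Some (vsort y)) (\<sigma> y)" if "clash b (\<sigma> y)"
    using not_clash_trans[of b "Var y" "\<sigma> y"] that Var by (auto simp: terms_Var_iff)
  then have "slot_rank w b (\<sigma> y) \<le> slot_rank w (Some (vsort y)) (\<sigma> y)"
    unfolding slot_rank_def by (cases "clash b (\<sigma> y)") auto
  also have "\<dots> \<le> k" using Var.prems by simp
  finally show ?case by simp
next
  case (Fun f ts)
  have "rank w (Fun f (map (\<lambda>t. subst t \<sigma>) ts)) \<le> k"
    unfolding rank_Fun_le
  proof (intro allI impI)
    fix i assume "i < length (map (\<lambda>t. subst t \<sigma>) ts)"
    then have i: "i < length ts" by simp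
    have "Fun f ts \<in> Terms" using Fun.hyps Fun.IH by (auto intro: terms.Fun)
    then have "slot_rank w (Some (arg_sort f i)) (subst (ts ! i) \<sigma>) \<le> k"
      using Fun.IH Fun.prems i rank0_arg[OF Fun.prems(1) i] slot_arg[OF _ i]
      by (metis UN_I nth_mem vars.simps(2))
    then show "slot_rank w (Some (arg_sort f i)) (map (\<lambda>t. subst t \<sigma>) ts ! i) \<le> k"
      using i by simp
  qed
  moreover have "\<not> clash b (Fun f (map (\<lambda>t. subst t \<sigma>) ts))"
    using Fun.prems(3) clash_Fun by blast
  ultimately show ?case by (simp add: slot_rank_def)
qed

text \<open>By strictness the slot of \<open>y\<close> in \<open>l\<close> is exactly
  \<open>vsort y\<close>, so a clash of \<open>\<sigma> y\<close> with that sort is already counted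
  in the rank of the instance.\<close>

lemma slot_rank_le_rank_lhs:
  "strict ty vsort l \<Longrightarrow> (\<And>x. l \<noteq> Var x) \<Longrightarrow> y \<in> vars l \<Longrightarrow>
    slot_rank w (Some (vsort y)) (\<sigma> y) \<le> rank w (subst l \<sigma>)"
proof (induction l)
  case (Fun f ts)
  then obtain i where i: "i < length ts" "y \<in> vars (ts ! i)" by (auto simp: in_set_conv_nth)
  have arg: "slot_rank w (Some (arg_sort f i)) (subst (ts ! i) \<sigma>) \<le> rank w (subst (Fun f ts) \<sigma>)"
    using slot_rank_arg_le[of i "map (\<lambda>t. subst t \<sigma>) ts" w f] i by simp
  show ?case
  proof (cases "ts ! i")
    case (Var x)
    then show ?thesis using arg i Fun.prems(1) by (auto simp del: clash.simps)
  next
    case inner: (Fun g us)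
    have "slot_rank w (Some (vsort y)) (\<sigma> y) \<le> rank w (subst (ts ! i) \<sigma>)"
    proof (rule Fun.IH)
      show "strict ty vsort (ts ! i)" using Fun.prems(1) i by (simp only: strict.simps)
    qed (use i inner nth_mem[OF i(1)] in simp_all)
    also have "\<dots> \<le> slot_rank w (Some (arg_sort f i)) (subst (ts ! i) \<sigma>)" by (rule rank_le_slot_rank)
    finally show ?thesis using arg by linarith
  qed
qed auto

text \<open>
  Strictness of the left-hand side makes the slot of a variable there the smallest possible one,
  so moving its instance to another slot of the right-hand side can only remove clashes.
\<close>

lemma slot_rank_rewr:
  "rewr R s t \<Longrightarrow> s \<in> Terms \<Longrightarrow> b \<in> slots \<Longrightarrow> slot_rank w b t \<le> slot_rank w b s"
proof (induction arbitrary: b rule: rewr.induct)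
  case (root l r \<sigma>)
  note rule = rule_facts[OF root.hyps]
  obtain f ts where l: "l = Fun f ts" using root.hyps by (rule lhs_Fun)
  have vars: "\<sigma> y \<in> Terms \<and> slot_rank w (Some (vsort y)) (\<sigma> y) \<le> rank w (subst l \<sigma>)" if "y \<in> vars r" for y
    using that rule(4) vars_subst_in_terms[OF root.prems(1)] slot_rank_le_rank_lhs[OF rule(8,3)] by auto
  have *: "slot_rank w c (subst r \<sigma>) \<le> rank w (subst l \<sigma>)" if "c \<in> slots" "\<not> clash c r" for c
    using slot_rank_subst_le[OF rule(2,6) that vars] by simp
  have clash: "clash b (subst l \<sigma>) \<longleftrightarrow> clash b l" using l clash_Fun by simp
  show ?case
  proof (cases "clash b l")
    case True
    have "slot_rank w b (subst r \<sigma>) \<le> Suc (rank w (subst r \<sigma>))" by (simp add: slot_rank_def)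
    also have "\<dots> \<le> Suc (rank w (subst l \<sigma>))" using *[of None] by simp
    also have "\<dots> = slot_rank w b (subst l \<sigma>)" using True clash by (simp add: slot_rank_def)
    finally show ?thesis .
  next
    case False
    \<comment> \<open>Compatibility puts the sort of \<open>r\<close> weakly below that of
      \<open>l\<close>, so \<open>r\<close> fits every slot that \<open>l\<close> fits.\<close>
    then have "\<not> clash b r" using not_clash_trans rule(1,2,7) root.prems(2) by blast
    from *[OF root.prems(2) this] show ?thesis using rank_le_slot_rank le_trans by blast
  qed
next
  case (arg i ss t f)
  have "slot_rank w (Some (arg_sort f j)) (ss[i := t] ! j) \<le> rank w (Fun f ss)" if j: "j < length ss" for j
  proof -
    have "slot_rank w (Some (arg_sort f j)) (ss[i := t] ! j) \<le> slot_rank w (Some (arg_sort f j)) (ss ! j)"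
      using arg.IH[of "Some (arg_sort f j)"] arg.prems(1) slot_arg[OF arg.prems(1) j] j
      by (cases "i = j") (auto simp: terms_Fun_iff)
    also have "\<dots> \<le> rank w (Fun f ss)" using j by (rule slot_rank_arg_le)
    finally show ?thesis .
  qed
  then have "rank w (Fun f (ss[i := t])) \<le> rank w (Fun f ss)" by (simp add: rank_Fun_le)
  moreover have "clash b (Fun f (ss[i := t])) \<longleftrightarrow> clash b (Fun f ss)" by (rule clash_Fun)
  ultimately show ?case by (simp add: slot_rank_def)
qed

lemma rewrs_in_terms: "(rewr R)\<^sup>*\<^sup>* s t \<Longrightarrow> s \<in> Terms \<Longrightarrow> t \<in> Terms"
  by (induction rule: rtranclp_induct) (auto intro: rewr_in_terms)

lemma slot_rank_rewrs:
  "(rewr R)\<^sup>*\<^sup>* s t \<Longrightarrow> s \<in> Terms \<Longrightarrow> b \<in> slots \<Longrightarrow> slot_rank w b t \<le> slot_rank w b s"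
proof (induction rule: rtranclp_induct)
  case (step t u)
  then show ?case using slot_rank_rewr[of t u b w] rewrs_in_terms[of s t] by linarith
qed simp

lemma rank_rewr: "rewr R s t \<Longrightarrow> s \<in> Terms \<Longrightarrow> rank w t \<le> rank w s"
  using slot_rank_rewr[of s t None w] by simp

lemma rank_rewrs: "(rewr R)\<^sup>*\<^sup>* s t \<Longrightarrow> s \<in> Terms \<Longrightarrow> rank w t \<le> rank w s"
  using slot_rank_rewrs[of s t None w] by simp


subsection \<open>Steps inside and outside of tall aliens\<close>

definition tall :: "nat \<Rightarrow> 's option \<Rightarrow> ('f, 'v) trm \<Rightarrow> bool" where
  "tall n b t \<longleftrightarrow> clash b t \<and> n \<le> rank0 t"

lemma tall_None [simp]: "\<not> tall n None t"
  by (simp add: tall_def)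

lemma not_tall_if_slot_rank_le: "slot_rank (\<lambda>_. 0) b t \<le> n \<Longrightarrow> \<not> tall n b t"
  by (auto simp: tall_def slot_rank_def)

text \<open>The clash of the alien itself takes one off the bound \<open>Suc n\<close>. Tall aliens
  thus come under the induction hypothesis for \<open>n\<close>.\<close>

lemma rank_le_if_tall: "tall n b t \<Longrightarrow> slot_rank (\<lambda>_. 0) b t \<le> Suc n \<Longrightarrow> rank0 t \<le> n"
  by (auto simp: tall_def slot_rank_def)

text \<open>A root step needs no condition on what lies below: \<open>l\<close> is order-sorted, so
  in its instance a clash can only occur at or below a variable of \<open>l\<close>. The slot of the
  whole term is the concern of \<open>outer_at\<close>.\<close>

inductive outer :: "nat \<Rightarrow> ('f, 'v) trm \<Rightarrow> ('f, 'v) trm \<Rightarrow> bool" for n where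
  root: "(l, r) \<in> R \<Longrightarrow> outer n (subst l \<sigma>) (subst r \<sigma>)"
| arg: "i < length ss \<Longrightarrow> \<not> tall n (Some (arg_sort f i)) (ss ! i) \<Longrightarrow> outer n (ss ! i) t \<Longrightarrow>
    outer n (Fun f ss) (Fun f (ss[i := t]))"

definition outer_at :: "nat \<Rightarrow> 's option \<Rightarrow> ('f, 'v) trm \<Rightarrow> ('f, 'v) trm \<Rightarrow> bool" where
  "outer_at n b s t \<longleftrightarrow> \<not> tall n b s \<and> outer n s t"

text \<open>All topmost tall aliens are rewritten in parallel, each by any number of steps, possibly
  none. Peaks of two such steps can then be treated argument by argument.\<close>

inductive inner :: "nat \<Rightarrow> 's option \<Rightarrow> ('f, 'v) trm \<Rightarrow> ('f, 'v) trm \<Rightarrow> bool" for n where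
  tall: "tall n b s \<Longrightarrow> (rewr R)\<^sup>*\<^sup>* s t \<Longrightarrow> inner n b s t"
| var: "\<not> tall n b (Var x) \<Longrightarrow> inner n b (Var x) (Var x)"
| args: "\<not> tall n b (Fun f ss) \<Longrightarrow> length ts = length ss \<Longrightarrow>
    (\<And>i. i < length ss \<Longrightarrow> inner n (Some (arg_sort f i)) (ss ! i) (ts ! i)) \<Longrightarrow>
    inner n b (Fun f ss) (Fun f ts)"

text \<open>
  A relaxation of inner steps that survives fusion: when a formerly tall alien clashes no longer, the
  steps in it still are \<open>mixed\<close> steps.
\<close>

inductive mixed :: "nat \<Rightarrow> 's option \<Rightarrow> ('f, 'v) trm \<Rightarrow> ('f, 'v) trm \<Rightarrow> bool" for n where
  jump: "clash b s \<or> rank0 s \<le> n \<Longrightarrow> (rewr R)\<^sup>*\<^sup>* s t \<Longrightarrow> mixed n b s t"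
| args: "\<not> clash b (Fun f ss) \<Longrightarrow> length ts = length ss \<Longrightarrow>
    (\<And>i. i < length ss \<Longrightarrow> mixed n (Some (arg_sort f i)) (ss ! i) (ts ! i)) \<Longrightarrow>
    mixed n b (Fun f ss) (Fun f ts)"

lemma outer_imp_rewr: "outer n s t \<Longrightarrow> rewr R s t"
  by (induction rule: outer.induct) (auto intro: rewr.intros)

lemma rewr_imp_outer: "rewr R s t \<Longrightarrow> rank0 s \<le> n \<Longrightarrow> outer n s t"
proof (induction rule: rewr.induct)
  case (root l r \<sigma>)
  then show ?case by (intro outer.root)
next
  case (arg i ss t f)
  then have "slot_rank (\<lambda>_. 0) (Some (arg_sort f i)) (ss ! i) \<le> n"
    unfolding rank_Fun_le by blast
  with arg show ?case
    using rank_le_slot_rank le_trans by (intro outer.arg not_tall_if_slot_rank_le) blast+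
qed

lemma rewrs_imp_outer_at:
  assumes "(rewr R)\<^sup>*\<^sup>* s t" "s \<in> Terms" "b \<in> slots" "slot_rank (\<lambda>_. 0) b s \<le> n"
  shows "(outer_at n b)\<^sup>*\<^sup>* s t"
  using assms
proof (induction rule: rtranclp_induct)
  case base
  then show ?case by simp
next
  case (step t u)
  have t: "slot_rank (\<lambda>_. 0) b t \<le> n"
    using slot_rank_rewrs[OF step.hyps(1) step.prems(1,2), of "\<lambda>_. 0"] step.prems(3) by linarith
  then have "rank0 t \<le> n" using rank_le_slot_rank le_trans by blast
  with t have "outer_at n b t u"
    unfolding outer_at_def using step.hyps(2) rewr_imp_outer not_tall_if_slot_rank_le by simp
  with step show ?case by (simp add: rtranclp.rtrancl_into_rtrancl)
qed

lemma inner_refl: "inner n b s s"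
proof (induction s arbitrary: b)
  case (Var x)
  then show ?case by (cases "tall n b (Var x)") (auto intro: inner.intros)
next
  case (Fun f ts)
  then show ?case by (cases "tall n b (Fun f ts)") (auto intro: inner.intros)
qed

lemma inner_imp_rewrs: "inner n b s t \<Longrightarrow> (rewr R)\<^sup>*\<^sup>* s t"
  by (induction rule: inner.induct) (auto intro: rewrs_Fun)

lemma mixed_imp_rewrs: "mixed n b s t \<Longrightarrow> (rewr R)\<^sup>*\<^sup>* s t"
  by (induction rule: mixed.induct) (auto intro: rewrs_Fun)

lemma inner_FunE:
  assumes "inner n b (Fun f ss) t" "\<not> tall n b (Fun f ss)"
  obtains ts where "t = Fun f ts" "length ts = length ss"
    "\<And>i. i < length ss \<Longrightarrow> inner n (Some (arg_sort f i)) (ss ! i) (ts ! i)"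
  using assms by (cases rule: inner.cases) auto

lemma inner_slot:
  assumes "inner n b s t" "\<not> tall n b s" "\<not> tall n b' s"
  shows "inner n b' s t"
  using assms by (cases rule: inner.cases) (auto intro: inner.intros)

text \<open>Unless the root is tall, inner steps keep it, and with it the clash with the slot; the
  rank does not grow.\<close>

lemma inner_not_tall:
  assumes "inner n b s t" "s \<in> Terms" "\<not> tall n b s"
  shows "\<not> tall n b t"
proof -
  have "clash b t \<longleftrightarrow> clash b s"
    using assms(1,3) by (cases rule: inner.cases) (auto simp: clash_Fun)
  moreover have "rank0 t \<le> rank0 s"
    using rank_rewrs[OF inner_imp_rewrs[OF assms(1)] assms(2)] .
  ultimately show ?thesis using assms(3) by (auto simp: tall_def)
qed

text \<open>The descent to the redex either meets a tall alien or reaches the redex without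
  one.\<close>

lemma rewr_imp_inner_or_outer_at: "rewr R s t \<Longrightarrow> inner n b s t \<or> outer_at n b s t"
proof (induction arbitrary: b rule: rewr.induct)
  case (root l r \<sigma>)
  then have "rewr R (subst l \<sigma>) (subst r \<sigma>)" by (rule rewr.root)
  then show ?case
    using root by (cases "tall n b (subst l \<sigma>)") (auto intro: inner.tall outer.root simp: outer_at_def)
next
  case (arg i ss t f)
  show ?case
  proof (cases "tall n b (Fun f ss)")
    case True
    then show ?thesis using rewr.arg[OF arg.hyps] by (auto intro: inner.tall)
  next
    case False
    from arg.IH[of "Some (arg_sort f i)"] show ?thesis
    proof
      assume *: "inner n (Some (arg_sort f i)) (ss ! i) t"
      have "inner n b (Fun f ss) (Fun f (ss[i := t]))"
      proof (rule inner.args)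
        fix j assume "j < length ss"
        then show "inner n (Some (arg_sort f j)) (ss ! j) (ss[i := t] ! j)"
          using * inner_refl by (cases "i = j") auto
      qed (use False in auto)
      then show ?thesis ..
    next
      assume "outer_at n (Some (arg_sort f i)) (ss ! i) t"
      then show ?thesis using False arg.hyps(1) by (auto simp: outer_at_def intro: outer.arg)
    qed
  qed
qed

lemma mixed_args:
  assumes "length ts = length ss"
    and "\<And>i. i < length ss \<Longrightarrow> mixed n (Some (arg_sort f i)) (ss ! i) (ts ! i)"
  shows "mixed n b (Fun f ss) (Fun f ts)"
proof (cases "clash b (Fun f ss)")
  case True
  moreover have "(rewr R)\<^sup>*\<^sup>* (Fun f ss) (Fun f ts)"
    using assms by (intro rewrs_Fun) (auto dest: mixed_imp_rewrs)
  ultimately show ?thesis by (intro mixed.jump) auto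
next
  case False
  then show ?thesis using assms by (intro mixed.args) auto
qed

text \<open>The hypothesis ranges over all slots because a variable of \<open>u\<close> may occur in
  several of them.\<close>

lemma mixed_subst:
  assumes "\<And>x b. x \<in> vars u \<Longrightarrow> mixed n b (\<sigma> x) (\<tau> x)"
  shows "mixed n b (subst u \<sigma>) (subst u \<tau>)"
  using assms
proof (induction u arbitrary: b)
  case (Fun f ts)
  have "mixed n b' (subst (ts ! i) \<sigma>) (subst (ts ! i) \<tau>)" if "i < length ts" for i b'
    using Fun.prems nth_mem[OF that] by (intro Fun.IH) auto
  then show ?case by (auto intro: mixed_args)
qed simp

lemma mixed_slot:
  assumes "mixed n None s t"
  shows "mixed n b s t"
proof (cases "clash b s")
  case True
  then show ?thesis using mixed_imp_rewrs[OF assms] by (intro mixed.jump) auto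
next
  case False
  from assms show ?thesis
    by (cases rule: mixed.cases) (auto intro: mixed.jump mixed_args)
qed

text \<open>A tall alien has rank at most \<open>n\<close> here, so \<open>jump\<close> accepts its
  steps in every slot \<open>b'\<close>. This freedom matters when an outer step moves the
  alien.\<close>

lemma inner_imp_mixed:
  "inner n b s t \<Longrightarrow> slot_rank (\<lambda>_. 0) b s \<le> Suc n \<Longrightarrow> mixed n b' s t"
proof (induction arbitrary: b' rule: inner.induct)
  case (tall b s t)
  then show ?case using rank_le_if_tall by (blast intro: mixed.jump)
next
  case (var b x)
  then show ?case by (intro mixed.jump) auto
next
  case (args b f ss ts)
  then have "rank0 (Fun f ss) \<le> Suc n" using rank_le_slot_rank le_trans by blast
  with args show ?case unfolding rank_Fun_le by (intro mixed_args) auto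
qed

text \<open>A \<open>jump\<close> is an inner step if it starts at a tall alien; otherwise it starts
  with slot rank at most \<open>n\<close>, where every step is outer. The inner parts of all
  arguments are done together, the outer parts one after another.\<close>

lemma mixed_imp_inner_outer_at:
  "mixed n b s t \<Longrightarrow> s \<in> Terms \<Longrightarrow> b \<in> slots \<Longrightarrow> slot_rank (\<lambda>_. 0) b s \<le> Suc n \<Longrightarrow>
    \<exists>u. inner n b s u \<and> (outer_at n b)\<^sup>*\<^sup>* u t"
proof (induction rule: mixed.induct)
  case (jump b s t)
  show ?case
  proof (cases "tall n b s")
    case True
    then show ?thesis using jump.hyps(2) by (blast intro: inner.tall)
  next
    case False
    with jump.hyps(1) have "slot_rank (\<lambda>_. 0) b s \<le> n"
      by (auto simp: tall_def slot_rank_def of_bool_def)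
    then show ?thesis using jump inner_refl rewrs_imp_outer_at by blast
  qed
next
  case (args b f ss ts)
  have "rank0 (Fun f ss) \<le> Suc n" using args.prems(3) rank_le_slot_rank le_trans by blast
  then have "\<exists>u. inner n (Some (arg_sort f i)) (ss ! i) u \<and> (outer_at n (Some (arg_sort f i)))\<^sup>*\<^sup>* u (ts ! i)"
    if "i < length ss" for i
    using that args.prems(1) slot_arg[OF args.prems(1) that]
    unfolding rank_Fun_le by (intro args.IH) (auto simp: terms_Fun_iff)
  then obtain u where u: "\<And>i. i < length ss \<Longrightarrow>
    inner n (Some (arg_sort f i)) (ss ! i) (u i) \<and> (outer_at n (Some (arg_sort f i)))\<^sup>*\<^sup>* (u i) (ts ! i)"
    by metis
  let ?us = "map u [0..<length ss]"
  \<comment> \<open>Whether the slot clashes depends on \<open>f\<close> only, so outer steps remain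
    possible whatever the arguments become.\<close>
  have no_clash: "\<not> tall n b (Fun f xs)" for xs
    using args.hyps(1) clash_Fun[of b f xs ss] by (simp add: tall_def)
  have "inner n b (Fun f ss) (Fun f ?us)"
    using u no_clash by (intro inner.args) auto
  moreover have "(outer_at n b)\<^sup>*\<^sup>* (Fun f ?us) (Fun f ts)"
  proof (rule rtranclp_update_all[where P = "\<lambda>i. outer_at n (Some (arg_sort f i))" and g = "Fun f"])
    fix xs i y
    assume "length xs = length ss" "i < length ss" "outer_at n (Some (arg_sort f i)) (xs ! i) y"
    then show "outer_at n b (Fun f xs) (Fun f (xs[i := y]))"
      using no_clash by (simp add: outer_at_def outer.arg)
  qed (use u args.hyps in auto)
  ultimately show ?case by blast
qed

section \<open>Closing peaks that contain an inner step\<close>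

definition confluent_up_to_rank :: "nat \<Rightarrow> bool" where
  "confluent_up_to_rank n \<longleftrightarrow> (\<forall>s \<in> Terms. rank0 s \<le> n \<longrightarrow>
     (\<forall>t u. (rewr R)\<^sup>*\<^sup>* s t \<longrightarrow> (rewr R)\<^sup>*\<^sup>* s u \<longrightarrow> (\<exists>v. (rewr R)\<^sup>*\<^sup>* t v \<and> (rewr R)\<^sup>*\<^sup>* u v)))"

text \<open>Two rewrite sequences of one tall alien are joined by the hypothesis for rank
  \<open>n\<close>. Their ends may have ceased to clash, but have rank at most \<open>n\<close>, so
  the joining sequences are \<open>mixed\<close>.\<close>

lemma inner_inner:
  assumes "confluent_up_to_rank n"
  shows "inner n b s t \<Longrightarrow> inner n b s u \<Longrightarrow> s \<in> Terms \<Longrightarrow> b \<in> slots \<Longrightarrow>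
    slot_rank (\<lambda>_. 0) b s \<le> Suc n \<Longrightarrow> \<exists>v. mixed n b t v \<and> mixed n b u v"
proof (induction arbitrary: u rule: inner.induct)
  case (tall b s t)
  have s: "rank0 s \<le> n" using tall.hyps(1) tall.prems(4) by (rule rank_le_if_tall)
  have u: "(rewr R)\<^sup>*\<^sup>* s u" using tall.prems(1) by (rule inner_imp_rewrs)
  from assms s tall.hyps(2) u tall.prems(2) obtain v where "(rewr R)\<^sup>*\<^sup>* t v" "(rewr R)\<^sup>*\<^sup>* u v"
    unfolding confluent_up_to_rank_def by blast
  moreover have "rank0 t \<le> n" "rank0 u \<le> n"
    using rank_rewrs[OF tall.hyps(2) tall.prems(2)] rank_rewrs[OF u tall.prems(2)] s le_trans by blast+
  ultimately show ?case by (blast intro: mixed.jump)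
next
  case (var b x)
  from var.prems(1) var.hyps have "u = Var x" by (cases rule: inner.cases) auto
  then show ?case by (auto intro!: exI[of _ "Var x"] mixed.jump)
next
  case (args b f ss ts)
  from args.prems(1) args.hyps(1) obtain us where us: "u = Fun f us" "length us = length ss"
    "\<And>i. i < length ss \<Longrightarrow> inner n (Some (arg_sort f i)) (ss ! i) (us ! i)"
    by (rule inner_FunE) blast
  have "rank0 (Fun f ss) \<le> Suc n" using args.prems(4) rank_le_slot_rank le_trans by blast
  then have "\<exists>v. mixed n (Some (arg_sort f i)) (ts ! i) v \<and> mixed n (Some (arg_sort f i)) (us ! i) v"
    if "i < length ss" for i
    using that us(3)[OF that] args.prems(2) slot_arg[OF args.prems(2) that]
    unfolding rank_Fun_le by (intro args.IH) (auto simp: terms_Fun_iff)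
  then obtain v where v: "\<And>i. i < length ss \<Longrightarrow>
    mixed n (Some (arg_sort f i)) (ts ! i) (v i) \<and> mixed n (Some (arg_sort f i)) (us ! i) (v i)"
    by metis
  then have "mixed n b (Fun f ts) (Fun f (map v [0..<length ss]))"
    "mixed n b (Fun f us) (Fun f (map v [0..<length ss]))"
    using args.hyps(2) us(2) by (auto intro!: mixed_args)
  then show ?case using us(1) by blast
qed

text \<open>A relation \<open>E\<close> that can be followed through non-clashing function symbols
  can be followed through the whole pattern, as \<open>l\<close> is order-sorted; by linearity the
  images of the variables combine to one substitution. Strictness provides the slot
  \<open>Some (vsort y)\<close> at each variable. The uses take inner steps, \<open>refines\<close>
  and \<open>base\<close> for \<open>E\<close>.\<close>

lemma match_lhs:
  assumes step: "\<And>b f ss t. E b (Fun f ss) t \<Longrightarrow> \<not> clash b (Fun f ss) \<Longrightarrow>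
      \<exists>ts. t = Fun f ts \<and> length ts = length ss \<and> (\<forall>i < length ss. E (Some (arg_sort f i)) (ss ! i) (ts ! i))"
  shows "linear l \<Longrightarrow> strict ty vsort l \<Longrightarrow> rank0 l = 0 \<Longrightarrow> \<not> clash b l \<Longrightarrow>
    (\<And>x. l = Var x \<Longrightarrow> b = Some (vsort x)) \<Longrightarrow> E b (subst l \<sigma>) t \<Longrightarrow>
    \<exists>\<tau>. t = subst l \<tau> \<and> (\<forall>y \<in> vars l. E (Some (vsort y)) (\<sigma> y) (\<tau> y))"
proof (induction l arbitrary: b t)
  case (Var x)
  then show ?case by (auto intro!: exI[of _ "\<lambda>_. t"])
next
  case (Fun f ls)
  have "\<not> clash b (Fun f (map (\<lambda>t. subst t \<sigma>) ls))"
    using Fun.prems(4) clash_Fun by blast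
  with Fun.prems(6) step[of b f "map (\<lambda>t. subst t \<sigma>) ls" t] obtain ts
    where t: "t = Fun f ts" "length ts = length ls"
      and E: "\<forall>i < length ls. E (Some (arg_sort f i)) (subst (ls ! i) \<sigma>) (ts ! i)"
    by (auto simp del: clash.simps)
  have "\<exists>\<tau>. ts ! i = subst (ls ! i) \<tau> \<and> (\<forall>y \<in> vars (ls ! i). E (Some (vsort y)) (\<sigma> y) (\<tau> y))"
    if i: "i < length ls" for i
  proof (rule Fun.IH)
    show "linear (ls ! i)" using Fun.prems(1) i by (rule linear_Fun_nth)
    show "E (Some (arg_sort f i)) (subst (ls ! i) \<sigma>) (ts ! i)" using E i by blast
  qed (use i Fun.prems(2) rank0_arg[OF Fun.prems(3) i] in auto)
  then obtain \<tau> where \<tau>: "\<And>i. i < length ls \<Longrightarrow> ts ! i = subst (ls ! i) (\<tau> i) \<and>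
    (\<forall>y \<in> vars (ls ! i). E (Some (vsort y)) (\<sigma> y) (\<tau> i y))"
    by metis
  \<comment> \<open>The argument that contains \<open>y\<close>, unique by linearity.\<close>
  define k where "k y = (SOME i. i < length ls \<and> y \<in> vars (ls ! i))" for y
  have k: "k y = i" if "i < length ls" "y \<in> vars (ls ! i)" for i y
    unfolding k_def using that linear_Fun_disjoint[OF Fun.prems(1)] by (intro some_equality) blast+
  let ?\<tau> = "\<lambda>y. \<tau> (k y) y"
  have "ts ! i = subst (ls ! i) ?\<tau>" if "i < length ls" for i
    using \<tau>[OF that] k[OF that] by (auto intro: subst_cong)
  then have "t = subst (Fun f ls) ?\<tau>" using t by (auto intro: nth_equalityI)
  moreover have "\<forall>y \<in> vars (Fun f ls). E (Some (vsort y)) (\<sigma> y) (?\<tau> y)"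
    using \<tau> k by (auto simp: in_set_conv_nth)
  ultimately show ?case by blast
qed

text \<open>Inner steps leave the pattern of an outer redex intact, and by left-linearity they may
  act on the instances of its variables independently, so the same rule applies afterwards. The
  outer step may copy aliens or move them to other slots, hence the \<open>mixed\<close> steps on
  its side.\<close>

lemma outer_inner:
  "outer n s t \<Longrightarrow> inner n None s s' \<Longrightarrow> s \<in> Terms \<Longrightarrow> rank0 s \<le> Suc n \<Longrightarrow>
    \<exists>u. outer n s' u \<and> mixed n None t u"
proof (induction arbitrary: s' rule: outer.induct)
  case (root l r \<sigma>)
  note rule = rule_facts[OF root.hyps]
  have "\<exists>\<tau>. s' = subst l \<tau> \<and> (\<forall>y \<in> vars l. inner n (Some (vsort y)) (\<sigma> y) (\<tau> y))"
  proof (rule match_lhs[where b = None])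
    fix b f ss t
    assume "inner n b (Fun f ss) t" "\<not> clash b (Fun f ss)"
    then show "\<exists>ts. t = Fun f ts \<and> length ts = length ss \<and>
      (\<forall>i < length ss. inner n (Some (arg_sort f i)) (ss ! i) (ts ! i))"
      by (auto elim!: inner_FunE simp: tall_def)
  qed (use rule root in auto)
  then obtain \<tau> where \<tau>: "s' = subst l \<tau>" "\<And>y. y \<in> vars l \<Longrightarrow> inner n (Some (vsort y)) (\<sigma> y) (\<tau> y)"
    by blast
  \<comment> \<open>This holds for every \<open>b\<close>, since \<open>r\<close> may put
    \<open>y\<close> into slots other than the one in \<open>l\<close>.\<close>
  have "mixed n b (\<sigma> y) (\<tau> y)" if "y \<in> vars r" for y b
    using that \<tau>(2)[of y] rule(4) slot_rank_le_rank_lhs[OF rule(8,3), of y "\<lambda>_. 0" \<sigma>] root.prems(3)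
    by (intro inner_imp_mixed) auto
  then have "mixed n None (subst r \<sigma>) (subst r \<tau>)" by (rule mixed_subst)
  then show ?case using \<tau>(1) outer.root[OF root.hyps] by blast
next
  case (arg i ss f t)
  from arg.prems(1) tall_None obtain ss' where ss': "s' = Fun f ss'" "length ss' = length ss"
    "\<And>i. i < length ss \<Longrightarrow> inner n (Some (arg_sort f i)) (ss ! i) (ss' ! i)"
    by (rule inner_FunE) blast
  have rank: "slot_rank (\<lambda>_. 0) (Some (arg_sort f j)) (ss ! j) \<le> Suc n" if "j < length ss" for j
    using arg.prems(3) that unfolding rank_Fun_le by blast
  have si: "ss ! i \<in> Terms" using arg.prems(2) arg.hyps(1) by (auto simp: terms_Fun_iff)
  have "inner n None (ss ! i) (ss' ! i)"
    using inner_slot[OF ss'(3)] arg.hyps(1,2) by simp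
  moreover have "rank0 (ss ! i) \<le> Suc n" using rank[OF arg.hyps(1)] rank_le_slot_rank le_trans by blast
  ultimately obtain u where u: "outer n (ss' ! i) u" "mixed n None t u"
    using arg.IH si by blast
  have "\<not> tall n (Some (arg_sort f i)) (ss' ! i)"
    using inner_not_tall[OF ss'(3)] arg.hyps(1,2) si by blast
  with u(1) have "outer n (Fun f ss') (Fun f (ss'[i := u]))"
    using arg.hyps(1) ss'(2) by (intro outer.arg) auto
  moreover have "mixed n None (Fun f (ss[i := t])) (Fun f (ss'[i := u]))"
  proof (rule mixed_args)
    fix j assume j: "j < length (ss[i := t])"
    then show "mixed n (Some (arg_sort f j)) (ss[i := t] ! j) (ss'[i := u] ! j)"
      using u(2) ss' rank by (cases "i = j") (auto intro: mixed_slot inner_imp_mixed)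
  qed (use ss'(2) in simp)
  ultimately show ?case using ss'(1) by blast
qed


subsection \<open>Replacing tall aliens by variables\<close>

text \<open>Subterms are paired with the sort of their slot, since the replacing variable must have
  that sort: equal aliens in slots of different sorts get different variables. All proper subterms
  are listed, whether tall or not.\<close>

fun occurrences :: "('f, 'v) trm \<Rightarrow> ('s \<times> ('f, 'v) trm) set" where
  "occurrences (Var x) = {}"
| "occurrences (Fun f ts) = (\<Union>i < length ts. insert (arg_sort f i, ts ! i) (occurrences (ts ! i)))"

text \<open>Holds for every subterm of \<open>s\<close> in its slot and is inherited by arguments,
  so that inductions on subterms can refer to a coding fixed for \<open>s\<close>.\<close>

definition occurs_in :: "('f, 'v) trm \<Rightarrow> 's option \<Rightarrow> ('f, 'v) trm \<Rightarrow> bool" where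
  "occurs_in s b t \<longleftrightarrow> occurrences t \<subseteq> occurrences s \<and> vars t \<subseteq> vars s \<and>
     (\<forall>\<beta>. b = Some \<beta> \<longrightarrow> (\<beta>, t) \<in> occurrences s)"

definition coding :: "('s \<times> ('f, 'v) trm \<Rightarrow> 'v) \<Rightarrow> ('f, 'v) trm \<Rightarrow> bool" where
  "coding c s \<longleftrightarrow> inj_on c (occurrences s) \<and>
     (\<forall>(\<beta>, t) \<in> occurrences s. c (\<beta>, t) \<in> vars_of_sort V vsort \<beta> - vars s)"

definition decode :: "('s \<times> ('f, 'v) trm \<Rightarrow> 'v) \<Rightarrow> ('f, 'v) trm \<Rightarrow> 'v \<Rightarrow> ('f, 'v) trm" where
  "decode c s x = (if x \<in> c ` occurrences s then snd (inv_into (occurrences s) c x) else Var x)"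

text \<open>With weight \<open>n\<close>, any clash on the path to a code raises the rank above
  \<open>n\<close>. Thus a bound \<open>n\<close> on the rank keeps codes out of clashing slots and
  from below them, and rewriting preserves this bound.\<close>

definition code_weight :: "nat \<Rightarrow> ('s \<times> ('f, 'v) trm \<Rightarrow> 'v) \<Rightarrow> ('f, 'v) trm \<Rightarrow> 'v \<Rightarrow> nat" where
  "code_weight n c s x = (if x \<in> c ` occurrences s then n else 0)"

text \<open>The slot \<open>None\<close> is never tall, so \<open>the\<close> is only applied to slots of the form \<open>Some \<beta>\<close>.\<close>

fun base :: "nat \<Rightarrow> ('s \<times> ('f, 'v) trm \<Rightarrow> 'v) \<Rightarrow> 's option \<Rightarrow> ('f, 'v) trm \<Rightarrow> ('f, 'v) trm" where
  "base n c b (Var x) = (if tall n b (Var x) then Var (c (the b, Var x)) else Var x)"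
| "base n c b (Fun f ts) = (if tall n b (Fun f ts) then Var (c (the b, Fun f ts))
     else Fun f (map (\<lambda>i. base n c (Some (arg_sort f i)) (ts ! i)) [0..<length ts]))"

lemma base_not_tall: "\<not> tall n b t \<Longrightarrow> base n c b t = base n c None t"
  by (cases t) auto

lemma occurs_in_self: "occurs_in s None s"
  by (simp add: occurs_in_def)

lemma occurs_in_None: "occurs_in s b t \<Longrightarrow> occurs_in s None t"
  by (simp add: occurs_in_def)

lemma occurs_in_arg:
  assumes "occurs_in s b (Fun f ts)" "i < length ts"
  shows "occurs_in s (Some (arg_sort f i)) (ts ! i)"
proof -
  have "insert (arg_sort f i, ts ! i) (occurrences (ts ! i)) \<subseteq> occurrences (Fun f ts)"
    using assms(2) by auto
  moreover have "vars (ts ! i) \<subseteq> vars (Fun f ts)" using nth_mem[OF assms(2)] by auto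
  ultimately show ?thesis using assms(1) unfolding occurs_in_def by blast
qed

lemma finite_occurrences: "finite (occurrences t)"
  by (induction t) auto

lemma occurrences_in: "t \<in> Terms \<Longrightarrow> (\<beta>, a) \<in> occurrences t \<Longrightarrow> \<beta> \<in> S"
proof (induction t rule: terms.induct)
  case (Fun f ts)
  then show ?case using arg_sort_in by (auto dest: nth_mem)
qed simp

lemma ex_coding:
  assumes "s \<in> Terms"
  shows "\<exists>c. coding c s"
proof -
  have "infinite (vars_of_sort V vsort (fst p) - vars s)" if "p \<in> occurrences s" for p
  proof -
    have "fst p \<in> S" using that occurrences_in[OF assms, of "fst p" "snd p"] by simp
    then have "infinite (vars_of_sort V vsort (fst p))"
      using sort_attachment unfolding sort_attachment_def by blast
    then show ?thesis using finite_vars by (rule Diff_infinite_finite[rotated])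
  qed
  from ex_inj_choice[OF finite_occurrences this] show ?thesis
    unfolding coding_def by fastforce
qed

lemma coding_occurs:
  assumes "coding c s" "occurs_in s (Some \<beta>) t"
  shows "decode c s (c (\<beta>, t)) = t" "code_weight n c s (c (\<beta>, t)) = n"
    "c (\<beta>, t) \<in> V" "vsort (c (\<beta>, t)) = \<beta>"
  using assms unfolding coding_def occurs_in_def decode_def code_weight_def vars_of_sort_def by auto

lemma coding_vars:
  assumes "coding c s" "x \<in> vars s"
  shows "decode c s x = Var x" "code_weight n c s x = 0"
  using assms unfolding coding_def decode_def code_weight_def by auto

lemma base_decode: "coding c s \<Longrightarrow> occurs_in s b t \<Longrightarrow> subst (base n c b t) (decode c s) = t"
proof (induction t arbitrary: b)
  case (Var x)
  then show ?case
    by (cases b) (auto simp: coding_occurs coding_vars occurs_in_def)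
next
  case (Fun f ts)
  show ?case
  proof (cases "tall n b (Fun f ts)")
    case True
    with Fun.prems show ?thesis by (cases b) (auto simp: coding_occurs)
  next
    case False
    with Fun show ?thesis by (auto intro!: nth_equalityI simp: occurs_in_arg)
  qed
qed

lemma base_in_terms: "coding c s \<Longrightarrow> t \<in> Terms \<Longrightarrow> occurs_in s b t \<Longrightarrow> base n c b t \<in> Terms"
proof (induction t arbitrary: b)
  case (Var x)
  then show ?case by (cases b) (auto simp: coding_occurs terms_Var_iff)
next
  case (Fun f ts)
  show ?case
  proof (cases "tall n b (Fun f ts)")
    case True
    with Fun.prems show ?thesis by (cases b) (auto simp: coding_occurs terms_Var_iff)
  next
    case False
    with Fun show ?thesis by (auto simp: terms_Fun_iff occurs_in_arg)
  qed
qed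

lemma base_trivial: "slot_rank (\<lambda>_. 0) b t \<le> n \<Longrightarrow> base n c b t = t"
proof (induction t arbitrary: b)
  case (Var x)
  then show ?case using not_tall_if_slot_rank_le by simp
next
  case (Fun f ts)
  have "rank0 (Fun f ts) \<le> n" using Fun.prems rank_le_slot_rank le_trans by blast
  then have "base n c (Some (arg_sort f i)) (ts ! i) = ts ! i" if "i < length ts" for i
    using that Fun.IH unfolding rank_Fun_le by auto
  then show ?case using not_tall_if_slot_rank_le[OF Fun.prems] by (auto intro: nth_equalityI)
qed

text \<open>A tall alien gives way to a variable of weight \<open>n\<close> that fits its slot. A
  term that clashes without being tall has rank below \<open>n\<close>, so it contains no tall
  aliens and is left unchanged. Elsewhere the bound follows from the arguments.\<close>

lemma slot_rank_base:
  "coding c s \<Longrightarrow> occurs_in s b t \<Longrightarrow> slot_rank (\<lambda>_. 0) b t \<le> Suc n \<Longrightarrow>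
    slot_rank (code_weight n c s) b (base n c b t) \<le> n"
proof (induction t arbitrary: b)
  case (Var x)
  then have "code_weight n c s x = 0" by (intro coding_vars) (auto simp: occurs_in_def)
  then show ?case
    using Var.prems by (cases b) (auto simp: slot_rank_def coding_occurs tall_def)
next
  case (Fun f ts)
  show ?case
  proof (cases "tall n b (Fun f ts)")
    case True
    with Fun.prems show ?thesis by (cases b) (auto simp: slot_rank_def coding_occurs)
  next
    case not_tall: False
    show ?thesis
    proof (cases "clash b (Fun f ts)")
      case True
      with not_tall have le: "slot_rank (\<lambda>_. 0) b (Fun f ts) \<le> n"
        by (simp add: tall_def slot_rank_def)
      have "rank (code_weight n c s) (Fun f ts) = rank0 (Fun f ts)"
        using Fun.prems by (intro rank_cong coding_vars) (auto simp: occurs_in_def)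
      with le show ?thesis unfolding base_trivial[OF le] by (simp add: slot_rank_def)
    next
      case False
      have "rank0 (Fun f ts) \<le> Suc n" using Fun.prems(3) rank_le_slot_rank le_trans by blast
      then have "rank (code_weight n c s)
          (Fun f (map (\<lambda>i. base n c (Some (arg_sort f i)) (ts ! i)) [0..<length ts])) \<le> n"
        using Fun.IH Fun.prems(1) occurs_in_arg[OF Fun.prems(2)] unfolding rank_Fun_le by auto
      then show ?thesis using not_tall False clash_Fun by (auto simp: slot_rank_def)
    qed
  qed
qed

text \<open>
  A variable occurring twice in \<open>u\<close> may stand for a tall alien at one of its occurrences only, so
  bases are compared by the following relation rather than by instantiation.
\<close>

inductive refines :: "('v \<Rightarrow> ('f, 'v) trm) \<Rightarrow> ('v \<Rightarrow> ('f, 'v) trm) \<Rightarrow> ('f, 'v) trm \<Rightarrow> ('f, 'v) trm \<Rightarrow> bool"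
  for \<sigma> \<tau> where
  var: "\<sigma> x = subst t \<tau> \<Longrightarrow> refines \<sigma> \<tau> (Var x) t"
| args: "length ts = length us \<Longrightarrow> (\<And>i. i < length us \<Longrightarrow> refines \<sigma> \<tau> (us ! i) (ts ! i)) \<Longrightarrow>
    refines \<sigma> \<tau> (Fun f us) (Fun f ts)"

lemma refines_FunE:
  assumes "refines \<sigma> \<tau> (Fun f us) t"
  obtains ts where "t = Fun f ts" "length ts = length us" "\<And>i. i < length us \<Longrightarrow> refines \<sigma> \<tau> (us ! i) (ts ! i)"
  using assms by (cases rule: refines.cases) auto

lemma refines_imp_eq: "refines \<sigma> \<tau> u t \<Longrightarrow> subst u \<sigma> = subst t \<tau>"
  by (induction rule: refines.induct) (auto intro!: nth_equalityI)

lemma refines_subst: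
  "(\<And>x. x \<in> vars u \<Longrightarrow> refines \<sigma> \<tau> (\<rho> x) (\<rho>' x)) \<Longrightarrow> refines \<sigma> \<tau> (subst u \<rho>) (subst u \<rho>')"
proof (induction u)
  case (Fun f ts)
  have "refines \<sigma> \<tau> (subst (ts ! i) \<rho>) (subst (ts ! i) \<rho>')" if "i < length ts" for i
    using Fun.prems nth_mem[OF that] by (intro Fun.IH) auto
  then show ?case by (auto intro: refines.args)
qed simp

text \<open>The function symbols of \<open>u\<close> are present in \<open>t\<close>, so a pattern
  matched in \<open>u\<close> is also matched in \<open>t\<close>; left-linearity allows the
  instances of the variables to be refined independently.\<close>

lemma refines_rewr:
  "rewr R u u' \<Longrightarrow> refines \<sigma> \<tau> u t \<Longrightarrow> \<exists>t'. rewr R t t' \<and> refines \<sigma> \<tau> u' t'"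
proof (induction arbitrary: t rule: rewr.induct)
  case (root l r \<rho>)
  note rule = rule_facts[OF root.hyps]
  have "\<exists>\<rho>'. t = subst l \<rho>' \<and> (\<forall>y \<in> vars l. refines \<sigma> \<tau> (\<rho> y) (\<rho>' y))"
  proof (rule match_lhs[where b = None])
    fix f us t
    assume "refines \<sigma> \<tau> (Fun f us) t"
    then show "\<exists>ts. t = Fun f ts \<and> length ts = length us \<and> (\<forall>i < length us. refines \<sigma> \<tau> (us ! i) (ts ! i))"
      by (auto elim!: refines_FunE)
  qed (use rule root in auto)
  then obtain \<rho>' where "t = subst l \<rho>'" "\<forall>y \<in> vars l. refines \<sigma> \<tau> (\<rho> y) (\<rho>' y)" by blast
  moreover from this rule(4) have "refines \<sigma> \<tau> (subst r \<rho>) (subst r \<rho>')" by (intro refines_subst) blast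
  ultimately show ?case using rewr.root[OF root.hyps] by blast
next
  case (arg i us u' f)
  from arg.prems obtain ts where ts: "t = Fun f ts" "length ts = length us"
    "\<And>i. i < length us \<Longrightarrow> refines \<sigma> \<tau> (us ! i) (ts ! i)" by (rule refines_FunE) blast
  with arg.IH arg.hyps(1) obtain t' where t': "rewr R (ts ! i) t'" "refines \<sigma> \<tau> u' t'" by blast
  have "rewr R (Fun f ts) (Fun f (ts[i := t']))" using t'(1) arg.hyps(1) ts(2) by (intro rewr.arg) auto
  moreover have "refines \<sigma> \<tau> (Fun f (us[i := u'])) (Fun f (ts[i := t']))"
  proof (rule refines.args)
    fix j assume "j < length (us[i := u'])"
    then show "refines \<sigma> \<tau> (us[i := u'] ! j) (ts[i := t'] ! j)"
      using ts(2,3) t'(2) by (cases "i = j") auto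
  qed (use ts(2) in simp)
  ultimately show ?case using ts(1) by blast
qed

lemma refines_rewrs:
  "(rewr R)\<^sup>*\<^sup>* u u' \<Longrightarrow> refines \<sigma> \<tau> u t \<Longrightarrow> \<exists>t'. (rewr R)\<^sup>*\<^sup>* t t' \<and> refines \<sigma> \<tau> u' t'"
proof (induction rule: rtranclp_induct)
  case (step u' u'')
  then obtain t' where t': "(rewr R)\<^sup>*\<^sup>* t t'" "refines \<sigma> \<tau> u' t'" by blast
  from refines_rewr[OF step.hyps(2) t'(2)] t'(1) show ?case
    by (blast intro: rtranclp.rtrancl_into_rtrancl)
qed auto

section \<open>Transfer of steps between terms and their bases\<close>

text \<open>Extracts what the transfer of steps needs from \<open>code_weight\<close> and
  \<open>decode\<close>: a term of rank below \<open>n\<close> contains no instantiated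
  variable.\<close>

definition abstraction :: "nat \<Rightarrow> ('v \<Rightarrow> nat) \<Rightarrow> ('v \<Rightarrow> ('f, 'v) trm) \<Rightarrow> bool" where
  "abstraction n w \<sigma> \<longleftrightarrow> (\<forall>x. w x = 0 \<and> \<sigma> x = Var x \<or> w x = n)"

lemma abstraction_decode: "abstraction n (code_weight n c s) (decode c s)"
  by (simp add: abstraction_def code_weight_def decode_def)

text \<open>If the instance clashed, the weighted rank of \<open>Fun f us\<close> would be below
  \<open>n\<close>. Then no variable of weight \<open>n\<close> would occur, the substitution would
  change nothing, and the rank would be too small for a tall alien.\<close>

lemma abstraction_not_tall:
  assumes "abstraction n w \<sigma>" "slot_rank w b (Fun f us) \<le> n"
  shows "\<not> tall n b (subst (Fun f us) \<sigma>)"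
proof
  assume tall: "tall n b (subst (Fun f us) \<sigma>)"
  then have "clash b (Fun f us)" using clash_Fun by (auto simp: tall_def)
  then have less: "rank w (Fun f us) < n" using assms(2) by (simp add: slot_rank_def)
  have "\<sigma> x = Var x" if "x \<in> vars (Fun f us)" for x
    using weight_le_rank[OF that, of w] less assms(1)[unfolded abstraction_def, rule_format, of x] by auto
  then have "subst (Fun f us) \<sigma> = Fun f us" by (rule subst_ident)
  with tall less rank0_le[of "Fun f us" w] show False by (simp add: tall_def)
qed

text \<open>No function symbol of \<open>u\<close> is the root of a tall alien in the instance, so
  \<open>base\<close> cuts only at or below the variables of \<open>u\<close>.\<close>

lemma refines_base:
  "abstraction n w \<sigma> \<Longrightarrow> coding c s \<Longrightarrow> occurs_in s b (subst u \<sigma>) \<Longrightarrow> slot_rank w b u \<le> n \<Longrightarrow>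
    refines \<sigma> (decode c s) u (base n c b (subst u \<sigma>))"
proof (induction u arbitrary: b)
  case (Var x)
  then show ?case by (auto intro: refines.var simp: base_decode)
next
  case (Fun f us)
  have not_tall: "\<not> tall n b (subst (Fun f us) \<sigma>)"
    using abstraction_not_tall Fun.prems(1,4) by blast
  have "rank w (Fun f us) \<le> n" using Fun.prems(4) rank_le_slot_rank le_trans by blast
  then have "refines \<sigma> (decode c s) (us ! i) (base n c (Some (arg_sort f i)) (subst (us ! i) \<sigma>))"
    if "i < length us" for i
    using that Fun.prems(1,2) occurs_in_arg[OF Fun.prems(3)[unfolded subst.simps], of i]
    unfolding rank_Fun_le by (intro Fun.IH) auto
  then show ?case using not_tall by (auto intro: refines.args)
qed

lemma rewr_imp_outer_subst:
  "rewr R u u' \<Longrightarrow> abstraction n w \<sigma> \<Longrightarrow> rank w u \<le> n \<Longrightarrow> outer n (subst u \<sigma>) (subst u' \<sigma>)"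
proof (induction rule: rewr.induct)
  case (root l r \<rho>)
  from outer.root[OF root.hyps] show ?case by (simp add: subst_subst)
next
  case (arg i us u' f)
  have le: "slot_rank w (Some (arg_sort f i)) (us ! i) \<le> n"
    using arg.prems(2) arg.hyps(1) unfolding rank_Fun_le by blast
  then have "rank w (us ! i) \<le> n" using rank_le_slot_rank le_trans by blast
  with arg have step: "outer n (subst (us ! i) \<sigma>) (subst u' \<sigma>)" by blast
  \<comment> \<open>A reducible term is not a variable, since no left-hand side is one;
    \<open>abstraction_not_tall\<close> then applies.\<close>
  from arg.hyps(2) obtain g vs where "us ! i = Fun g vs"
    by (cases rule: rewr.cases) (auto elim: lhs_Fun)
  with le arg.prems(1) have "\<not> tall n (Some (arg_sort f i)) (subst (us ! i) \<sigma>)"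
    using abstraction_not_tall by metis
  with step have "outer n (Fun f (map (\<lambda>t. subst t \<sigma>) us))
      (Fun f ((map (\<lambda>t. subst t \<sigma>) us)[i := subst u' \<sigma>]))"
    using arg.hyps(1) by (intro outer.arg) auto
  then show ?case by (simp add: map_update)
qed

text \<open>No tall alien starts inside the pattern, so the redex is still present in the base. The
  reduct \<open>u\<close> decodes to \<open>t'\<close> but need not be the base of
  \<open>t'\<close>, as aliens may have fused with the layer above them.\<close>

lemma outer_imp_rewr_base:
  "outer n t t' \<Longrightarrow> coding c s \<Longrightarrow> occurs_in s b t \<Longrightarrow> \<not> tall n b t \<Longrightarrow>
    \<exists>u. rewr R (base n c b t) u \<and> subst u (decode c s) = t'"
proof (induction arbitrary: b rule: outer.induct)
  case (root l r \<sigma>)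
  note rule = rule_facts[OF root.hyps]
  have "\<exists>\<tau>. base n c None (subst l \<sigma>) = subst l \<tau> \<and>
    (\<forall>y \<in> vars l. \<tau> y = base n c (Some (vsort y)) (\<sigma> y) \<and> occurs_in s (Some (vsort y)) (\<sigma> y))"
  proof (rule match_lhs[where b = None])
    fix b f ss t
    assume "t = base n c b (Fun f ss) \<and> occurs_in s b (Fun f ss)" "\<not> clash b (Fun f ss)"
    then show "\<exists>ts. t = Fun f ts \<and> length ts = length ss \<and> (\<forall>i < length ss.
        ts ! i = base n c (Some (arg_sort f i)) (ss ! i) \<and> occurs_in s (Some (arg_sort f i)) (ss ! i))"
      using occurs_in_arg by (auto simp: tall_def)
  qed (use rule occurs_in_None[OF root.prems(2)] in auto)
  then obtain \<tau> where \<tau>: "base n c None (subst l \<sigma>) = subst l \<tau>"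
    "\<And>y. y \<in> vars l \<Longrightarrow> subst (\<tau> y) (decode c s) = \<sigma> y"
    using base_decode[OF root.prems(1)] by metis
  have "subst (subst r \<tau>) (decode c s) = subst r \<sigma>"
    using \<tau>(2) rule(4) unfolding subst_subst by (auto intro: subst_cong)
  then show ?case
    using rewr.root[OF root.hyps, of \<tau>] \<tau>(1) base_not_tall[OF root.prems(3)] by metis
next
  case (arg i ss f t)
  let ?b = "Some (arg_sort f i)"
  let ?us = "map (\<lambda>i. base n c (Some (arg_sort f i)) (ss ! i)) [0..<length ss]"
  have occ: "occurs_in s (Some (arg_sort f j)) (ss ! j)" if "j < length ss" for j
    using arg.prems(2) that by (rule occurs_in_arg)
  from arg.IH[OF arg.prems(1) occ] arg.hyps obtain u
    where u: "rewr R (base n c ?b (ss ! i)) u" "subst u (decode c s) = t" by blast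
  then have "rewr R (Fun f ?us) (Fun f (?us[i := u]))"
    using arg.hyps(1) by (intro rewr.arg) auto
  moreover have "subst (Fun f (?us[i := u])) (decode c s) = Fun f (ss[i := t])"
  proof -
    have "subst (?us[i := u] ! j) (decode c s) = ss[i := t] ! j" if "j < length ss" for j
      using u(2) base_decode[OF arg.prems(1) occ] that by (cases "i = j") auto
    then show ?thesis by (auto intro: nth_equalityI)
  qed
  ultimately show ?case using arg.prems(3) by auto
qed

text \<open>The instantiated term is existentially quantified because a reduct arises as an instance
  of a reduct of some base, which in general is not its own base.\<close>

definition base_steps :: "nat \<Rightarrow> ('f, 'v) trm \<Rightarrow> ('f, 'v) trm \<Rightarrow> bool" where
  "base_steps n s t \<longleftrightarrow> (\<exists>w \<sigma> u u'. abstraction n w \<sigma> \<and> u \<in> Terms \<and> rank w u \<le> n \<and>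
     (rewr R)\<^sup>*\<^sup>* u u' \<and> s = subst u \<sigma> \<and> t = subst u' \<sigma>)"

lemma base_steps_imp_outers:
  assumes "base_steps n s t"
  shows "(outer n)\<^sup>*\<^sup>* s t"
proof -
  from assms obtain w \<sigma> u u' where u: "abstraction n w \<sigma>" "u \<in> Terms" "rank w u \<le> n"
    and eqs: "s = subst u \<sigma>" "t = subst u' \<sigma>" and "(rewr R)\<^sup>*\<^sup>* u u'"
    unfolding base_steps_def by blast
  from this(6) have "(outer n)\<^sup>*\<^sup>* (subst u \<sigma>) (subst u' \<sigma>)"
  proof (induction rule: rtranclp_induct)
    case (step u' u'')
    have "rank w u' \<le> n" using rank_rewrs[OF step.hyps(1) u(2), of w] u(3) by linarith
    with step u(1) show ?case
      by (meson rewr_imp_outer_subst rtranclp.rtrancl_into_rtrancl)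
  qed simp
  with eqs show ?thesis by simp
qed

text \<open>The base of \<open>s\<close> refines every other presentation \<open>u\<close> of
  \<open>s\<close>, and refinement simulates rewriting. Steps presented differently thus become
  steps from one common term.\<close>

lemma base_steps_imp_rewrs_base:
  assumes "base_steps n s t" "coding c s"
  shows "\<exists>u. (rewr R)\<^sup>*\<^sup>* (base n c None s) u \<and> t = subst u (decode c s)"
proof -
  from assms(1) obtain w \<sigma> u u' where u: "abstraction n w \<sigma>" "rank w u \<le> n" "(rewr R)\<^sup>*\<^sup>* u u'"
    and eqs: "s = subst u \<sigma>" "t = subst u' \<sigma>"
    unfolding base_steps_def by blast
  have "refines \<sigma> (decode c s) u (base n c None s)"
    using refines_base[OF u(1) assms(2), of None u] u(2) eqs(1) occurs_in_self by simp
  from refines_rewrs[OF u(3) this] refines_imp_eq eqs(2) show ?thesis by blast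
qed

lemma rank_base:
  assumes "coding c s" "rank0 s \<le> Suc n"
  shows "rank (code_weight n c s) (base n c None s) \<le> n"
  using slot_rank_base[OF assms(1) occurs_in_self] assms(2) by simp

lemma outer_imp_base_steps:
  assumes "outer n s t" "s \<in> Terms" "rank0 s \<le> Suc n"
  shows "base_steps n s t"
proof -
  obtain c where c: "coding c s" using ex_coding[OF assms(2)] by blast
  from outer_imp_rewr_base[OF assms(1) c occurs_in_self] obtain u
    where u: "rewr R (base n c None s) u" "subst u (decode c s) = t" by auto
  have "s = subst (base n c None s) (decode c s)"
    using base_decode[OF c occurs_in_self] by simp
  with u show ?thesis
    using base_in_terms[OF c assms(2) occurs_in_self] rank_base[OF c assms(3)] abstraction_decode
    unfolding base_steps_def by blast
qed

text \<open>Both sequences are transferred to the base of \<open>s\<close>, whose rank is at most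
  \<open>n\<close>; the joining sequences found there are decoded again.\<close>

lemma base_steps_diamond:
  assumes "confluent_up_to_rank n" "s \<in> Terms" "rank0 s \<le> Suc n" "base_steps n s t" "base_steps n s t'"
  shows "\<exists>v. base_steps n t v \<and> base_steps n t' v"
proof -
  obtain c where c: "coding c s" using ex_coding[OF assms(2)] by blast
  let ?u = "base n c None s" and ?w = "code_weight n c s" and ?\<sigma> = "decode c s"
  obtain u u' where u: "(rewr R)\<^sup>*\<^sup>* ?u u" "t = subst u ?\<sigma>"
    and u': "(rewr R)\<^sup>*\<^sup>* ?u u'" "t' = subst u' ?\<sigma>"
    using assms(4,5) base_steps_imp_rewrs_base[OF _ c] by blast
  have base: "?u \<in> Terms" "rank ?w ?u \<le> n"
    using base_in_terms[OF c assms(2) occurs_in_self] rank_base[OF c assms(3)] by auto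
  then have "rank0 ?u \<le> n" using rank0_le le_trans by blast
  with assms(1) base(1) u(1) u'(1) obtain v where v: "(rewr R)\<^sup>*\<^sup>* u v" "(rewr R)\<^sup>*\<^sup>* u' v"
    unfolding confluent_up_to_rank_def by blast
  have "u \<in> Terms" "rank ?w u \<le> n" "u' \<in> Terms" "rank ?w u' \<le> n"
    using rank_rewrs[OF _ base(1), of _ ?w] rewrs_in_terms[OF _ base(1)] base(2) u(1) u'(1) le_trans
    by blast+
  then have "base_steps n t (subst v ?\<sigma>)" "base_steps n t' (subst v ?\<sigma>)"
    using v u(2) u'(2) abstraction_decode unfolding base_steps_def by blast+
  then show ?thesis by blast
qed

subsection \<open>Induction on the rank\<close>

text \<open>\<open>B\<close> has the diamond property and lies between \<open>Out\<close> and its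
  reflexive transitive closure, so both relations have the same closure.\<close>

lemma outers_confluent:
  fixes n :: nat
  defines "Out \<equiv> \<lambda>s t. s \<in> Terms \<and> rank0 s \<le> Suc n \<and> outer n s t"
  assumes "confluent_up_to_rank n"
  shows "confluentp Out"
proof -
  define B where "B s t \<longleftrightarrow> s \<in> Terms \<and> rank0 s \<le> Suc n \<and> base_steps n s t" for s t
  have Out_star: "Out\<^sup>*\<^sup>* s t \<and> t \<in> Terms \<and> rank0 t \<le> Suc n"
    if "s \<in> Terms" "rank0 s \<le> Suc n" "(outer n)\<^sup>*\<^sup>* s t" for s t
    using that(3)
  proof (induction rule: rtranclp_induct)
    case (step t u)
    then have "Out t u" by (simp add: Out_def)
    moreover have "u \<in> Terms" "rank0 u \<le> Suc n"
      using step rewr_in_terms[of t u] rank_rewr[of t u "\<lambda>_. 0"] outer_imp_rewr[of n t u] by auto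
    ultimately show ?case using step.IH by (auto intro: rtranclp.rtrancl_into_rtrancl)
  qed (use that in simp)
  have B_Out: "Out\<^sup>*\<^sup>* s t \<and> t \<in> Terms \<and> rank0 t \<le> Suc n" if "B s t" for s t
    using that Out_star base_steps_imp_outers unfolding B_def by blast
  have Out_B: "B s t" if "Out s t" for s t
    using that outer_imp_base_steps unfolding Out_def B_def by blast
  have "strong_confluentp B"
  proof (rule strong_confluentpI)
    fix s t u assume "B s t" "B s u"
    then obtain v where "B t v" "B u v"
      using base_steps_diamond[OF assms(2)] B_Out unfolding B_def by meson
    then show "\<exists>v. B\<^sup>*\<^sup>* t v \<and> B\<^sup>=\<^sup>= u v" by blast
  qed
  then have "confluentp B" by (rule strong_confluentp_imp_confluentp)
  moreover have "B\<^sup>*\<^sup>* = Out\<^sup>*\<^sup>*"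
  proof (rule rtranclp_subset)
    show "Out \<le> B" using Out_B by blast
    show "B \<le> Out\<^sup>*\<^sup>*" using B_Out by blast
  qed
  ultimately show ?thesis by (simp add: confluentp_def rtranclp_conversep)
qed

lemma confluent_up_to_rank_Suc:
  assumes "confluent_up_to_rank n"
  shows "confluent_up_to_rank (Suc n)"
proof -
  define X where "X = {s \<in> Terms. rank0 s \<le> Suc n}"
  define A where "A s t \<longleftrightarrow> s \<in> X \<and> rewr R s t" for s t
  define Out where "Out s t \<longleftrightarrow> s \<in> X \<and> outer n s t" for s t
  define Inn where "Inn s t \<longleftrightarrow> s \<in> X \<and> inner n None s t" for s t
  have X: "t \<in> X \<and> A\<^sup>*\<^sup>* s t" if "s \<in> X" "(rewr R)\<^sup>*\<^sup>* s t" for s t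
    using that(2)
  proof (induction rule: rtranclp_induct)
    case (step t u)
    then have "A t u" by (simp add: A_def)
    moreover have "u \<in> X"
      using step rewr_in_terms[of t u] rank_rewr[of t u "\<lambda>_. 0"] by (auto simp: X_def)
    ultimately show ?case using step.IH by (auto intro: rtranclp.rtrancl_into_rtrancl)
  qed (use that in simp)
  have Out_star: "Out\<^sup>*\<^sup>* s t" if "s \<in> X" "(outer n)\<^sup>*\<^sup>* s t" for s t
  proof -
    have "Out\<^sup>*\<^sup>* s t \<and> t \<in> X" using that(2)
    proof (induction rule: rtranclp_induct)
      case (step t u)
      then have "Out t u" "u \<in> X" using X[of t u] outer_imp_rewr[of n t u] by (auto simp: Out_def)
      with step.IH show ?case by (auto intro: rtranclp.rtrancl_into_rtrancl)
    qed (use that in simp)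
    then show ?thesis ..
  qed
  have mixed_imp: "(Inn OO Out\<^sup>*\<^sup>*) s t" if "s \<in> X" "mixed n None s t" for s t
  proof -
    from mixed_imp_inner_outer_at[OF that(2)] that(1) obtain u
      where u: "inner n None s u" "(outer_at n None)\<^sup>*\<^sup>* u t" by (auto simp: X_def)
    have "outer_at n None = outer n" by (intro ext) (simp add: outer_at_def)
    with u(2) X[OF that(1) inner_imp_rewrs[OF u(1)]] have "Out\<^sup>*\<^sup>* u t" using Out_star by simp
    moreover have "Inn s u" using u(1) that(1) by (simp add: Inn_def)
    ultimately show ?thesis by (rule relcomppI[rotated])
  qed
  have "\<exists>v. A\<^sup>*\<^sup>* t v \<and> A\<^sup>*\<^sup>* u v" if "A\<^sup>*\<^sup>* s t" "A\<^sup>*\<^sup>* s u" for s t u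
  proof (rule confluence_by_two_labels[of Out Inn A])
    fix s t u assume "Out\<^sup>*\<^sup>* s t" "Out\<^sup>*\<^sup>* s u"
    moreover have "Out = (\<lambda>s t. s \<in> Terms \<and> rank0 s \<le> Suc n \<and> outer n s t)"
      by (auto simp: Out_def X_def fun_eq_iff)
    ultimately show "\<exists>v. Out\<^sup>*\<^sup>* t v \<and> Out\<^sup>*\<^sup>* u v"
      using confluentpD[OF outers_confluent[OF assms]] by simp
  next
    fix s t u assume *: "Inn s t" "Inn s u"
    then obtain v where "mixed n None t v" "mixed n None u v"
      using inner_inner[OF assms, of None s t u] by (auto simp: Inn_def X_def)
    moreover have "t \<in> X" "u \<in> X" using * X[OF _ inner_imp_rewrs] unfolding Inn_def by blast+
    ultimately show "\<exists>v. (Inn OO Out\<^sup>*\<^sup>*) t v \<and> (Inn OO Out\<^sup>*\<^sup>*) u v"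
      by (intro exI[of _ v] conjI mixed_imp)
  next
    fix s t u assume *: "Out s t" "Inn s u"
    then obtain v where v: "outer n u v" "mixed n None t v"
      using outer_inner[of n s t u] by (auto simp: Out_def Inn_def X_def)
    have "t \<in> X" using * X[of s t] outer_imp_rewr[of n s t] by (simp add: Out_def r_into_rtranclp)
    moreover have "u \<in> X" using * X[OF _ inner_imp_rewrs] unfolding Inn_def by blast
    ultimately show "\<exists>v. (Inn OO Out\<^sup>*\<^sup>*) t v \<and> Out\<^sup>*\<^sup>* u v"
      using v by (intro exI[of _ v] conjI mixed_imp) (simp_all add: Out_def r_into_rtranclp)
  next
    fix s t assume A: "A s t"
    then have s: "s \<in> X" "rewr R s t" by (simp_all add: A_def)
    have t: "t \<in> X" using X[of s t] s by (simp add: r_into_rtranclp)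
    from rewr_imp_inner_or_outer_at[OF s(2), of n None]
    show "(Inn OO Out\<^sup>*\<^sup>*) s t"
    proof
      assume "inner n None s t"
      with s(1) have "Inn s t" by (simp add: Inn_def)
      then show ?thesis by (rule relcomppI) simp
    next
      assume "outer_at n None s t"
      with s(1) have "Out s t" by (simp add: Out_def outer_at_def)
      \<comment> \<open>An outer step is preceded by an empty inner step.\<close>
      moreover have "Inn s s" using s(1) inner_refl by (simp add: Inn_def)
      ultimately show ?thesis by (intro relcomppI[of Inn s s]) auto
    qed
  next
    fix s t assume "Out s t"
    then show "A\<^sup>*\<^sup>* s t" using outer_imp_rewr by (auto simp: Out_def A_def)
  next
    fix s t assume "Inn s t"
    then show "A\<^sup>*\<^sup>* s t" using X inner_imp_rewrs unfolding Inn_def by blast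
  qed (fact that)+
  moreover have "(rewr R)\<^sup>*\<^sup>* s t" if "A\<^sup>*\<^sup>* s t" for s t
    using that by (rule rtranclp_mono[THEN predicate2D, rotated]) (auto simp: A_def)
  ultimately show ?thesis
    using X unfolding confluent_up_to_rank_def X_def by (metis (mono_tags, lifting) mem_Collect_eq)
qed

section \<open>From order-sorted terms to all terms\<close>

lemma order_sorted_terms_iff:
  "t \<in> Terms \<Longrightarrow> t \<in> order_sorted_terms F V S gt ty vsort \<longleftrightarrow> rank0 t = 0"
  unfolding order_sorted_terms_def terms_of_sort_def
  using has_sort_imp rank0_imp_has_sort sort_of_in by blast

text \<open>Rewriting preserves rank zero, so sequences from an order-sorted term stay among the
  order-sorted terms.\<close>

lemma confluent_up_to_rank_0:
  assumes "confluent_on (rstep F ar V R) (order_sorted_terms F V S gt ty vsort)"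
  shows "confluent_up_to_rank 0"
proof -
  let ?T = "order_sorted_terms F V S gt ty vsort"
  let ?A = "\<lambda>s t. s \<in> ?T \<and> t \<in> ?T \<and> rstep F ar V R s t"
  have conf: "confluentp ?A" using assms unfolding confluent_on_def by blast
  have to_A: "?A\<^sup>*\<^sup>* s t" if "s \<in> Terms" "rank0 s \<le> 0" "(rewr R)\<^sup>*\<^sup>* s t" for s t
    using that(3)
  proof (induction rule: rtranclp_induct)
    case (step t u)
    have "t \<in> Terms" "rank0 t = 0" "u \<in> Terms" "rank0 u = 0"
      using rewrs_in_terms[of s] rank_rewrs[of s _ "\<lambda>_. 0"] that(1,2) step.hyps
        rtranclp.rtrancl_into_rtrancl[OF step.hyps] by fastforce+
    with step.hyps(2) have "?A t u" using order_sorted_terms_iff unfolding rstep_iff_rewr by blast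
    with step.IH show ?case by (rule rtranclp.rtrancl_into_rtrancl)
  qed simp
  have from_A: "(rewr R)\<^sup>*\<^sup>* s t" if "?A\<^sup>*\<^sup>* s t" for s t
    using that by (rule rtranclp_mono[THEN predicate2D, rotated]) (auto simp: rstep_iff_rewr)
  show ?thesis
    unfolding confluent_up_to_rank_def using to_A from_A confluentpD[OF conf] by meson
qed

end

theorem theorem6p6:
  fixes F :: "'f set" and ar :: "'f \<Rightarrow> nat" and V :: "'v set"
    and S :: "'s set" and gt :: "'s \<Rightarrow> 's \<Rightarrow> bool"
    and ty :: "'f \<Rightarrow> 's list \<times> 's" and vsort :: "'v \<Rightarrow> 's"
    and R :: "('f, 'v) rules"
  assumes "precedence S gt"
    and "sort_attachment F ar V S ty vsort"
    and "trs F ar V R"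
    and "compatible F V S gt ty vsort R"
    and "left_linear R"
    and "confluent_on (rstep F ar V R) (order_sorted_terms F V S gt ty vsort)"
  shows "confluent_on (rstep F ar V R) (terms F ar V)"
proof -
  interpret order_sorted_trs F ar V S gt ty vsort R
    using assms by unfold_locales
  let ?A = "\<lambda>s t. s \<in> Terms \<and> t \<in> Terms \<and> rstep F ar V R s t"
  \<comment> \<open>Every term has a finite rank, so the induction reaches all of them.\<close>
  have conf: "confluent_up_to_rank n" for n
    using confluent_up_to_rank_0[OF assms(6)] confluent_up_to_rank_Suc by (induction n) auto
  have A_iff: "?A s t \<longleftrightarrow> s \<in> Terms \<and> rewr R s t" for s t
    unfolding rstep_iff_rewr using rewr_in_terms by blast
  have to_A: "?A\<^sup>*\<^sup>* s t" if "s \<in> Terms" "(rewr R)\<^sup>*\<^sup>* s t" for s t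
    using that(2)
  proof (induction rule: rtranclp_induct)
    case (step t u)
    then have "?A t u" using rewrs_in_terms[OF step.hyps(1) that(1)] A_iff by blast
    with step.IH show ?case by (rule rtranclp.rtrancl_into_rtrancl)
  qed simp
  have from_A: "(rewr R)\<^sup>*\<^sup>* s t" if "?A\<^sup>*\<^sup>* s t" for s t
    using that by (rule rtranclp_mono[THEN predicate2D, rotated]) (auto simp: rstep_iff_rewr)
  have "confluentp ?A"
  proof (rule confluentpI)
    fix s t u assume st: "?A\<^sup>*\<^sup>* s t" and su: "?A\<^sup>*\<^sup>* s u"
    show "\<exists>v. ?A\<^sup>*\<^sup>* t v \<and> ?A\<^sup>*\<^sup>* u v"
    proof (cases "s \<in> Terms")
      case True
      with conf[of "rank0 s"] from_A[OF st] from_A[OF su] obtain v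
        where "(rewr R)\<^sup>*\<^sup>* t v" "(rewr R)\<^sup>*\<^sup>* u v"
        unfolding confluent_up_to_rank_def by blast
      then show ?thesis using to_A rewrs_in_terms True from_A[OF st] from_A[OF su] by blast
    next
      \<comment> \<open>\<open>confluentp\<close> ranges over all raw terms; outside of
        \<open>Terms\<close> there are no steps.\<close>
      case False
      then have "t = s" "u = s" using st su by (auto elim: converse_rtranclpE)
      then show ?thesis by blast
    qed
  qed
  then show ?thesis unfolding confluent_on_def by (auto simp: rstep_def)
qed

end
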